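(* Every $n$-qubit circuit consisting of Clifford gates and $N$ non-Clifford $Z$-phase gates can be implemented (up to global phase) by a circuit on $n$ qubits consisting of single-qubit unitaries and at most $N+6n-8$ targeted $\mathrm{GMS}$ gates.
   Context: For a set $S$ of qubits and a real $\alpha$, the (targeted) global Mølmer-Sørensen gate is $\mathrm{GMS}_S(\alpha)=\exp\bigl(-i\frac{\alpha}{4}\sum_{i\neq j\in S}X_iX_j\bigr)$, where the sum is over ordered pairs of distinct elements of $S$ and $X_i$ is the Pauli $X$ on qubit $i$; equivalently $\mathrm{GMS}_S(\alpha)=\prod_{i<j\in S}\exp(-i\frac{\alpha}{2}X_iX_j)$. "Targeted" means that each $\mathrm{GMS}$ gate may be applied to any subset $S$ of the $n$ qubits (with any angle $\alpha$), where the subset may differ from gate to gate. The $Z$-phase gate with angle $\alpha\in[0,2\pi]$ on qubit $i$ is $Z_i(\alpha)=\exp(-i\frac{\alpha}{2}Z_i)$, with $Z_i$ the Pauli $Z$ on qubit $i$; it is non-Clifford if $\alpha\neq k\frac{\pi}{2}$ for all $k\in\mathbb{Z}$. The Clifford gates in the input circuit are $S=\mathrm{diag}(1,i)$, Hadamard, CNOT and CZ gates. The number of Clifford gates in the input circuit, and of single-qubit unitaries in the output circuit, is unrestricted.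
   Formalization: Where N+6n-8 is negative (n=1 with N at most 1, or no qubits), the bound is read as 0 GMS gates, since no circuit can have a negative number of gates; all other cases are as stated. *)

theory Defs
  imports "HOL-Analysis.Analysis" "Jordan_Normal_Form.Schur_Decomposition"
begin

text \<open>
  Operators on \<open>n\<close> qubits are complex matrices of dimension \<open>2 ^ n\<close>. The computational basis
  states are numbered \<open>x < 2 ^ n\<close>, and qubit \<open>i < n\<close> is in the state \<open>bit x i\<close>.
\<close>

definition on_qubit :: "nat \<Rightarrow> nat \<Rightarrow> complex mat \<Rightarrow> complex mat" where
  \<comment> \<open>the tensor product of the \<open>2 \<times> 2\<close> matrix \<open>A\<close> on qubit \<open>i\<close> with identities elsewhere\<close>
  "on_qubit n i A = mat (2 ^ n) (2 ^ n) (\<lambda>(x, y).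
     if \<forall>j<n. j \<noteq> i \<longrightarrow> bit x j = bit y j
     then A $$ (of_bool (bit x i), of_bool (bit y i)) else 0)"

definition pauli_X :: "complex mat" where
  "pauli_X = mat_of_rows_list 2 [[0, 1], [1, 0]]"

definition pauli_Z :: "complex mat" where
  "pauli_Z = mat_of_rows_list 2 [[1, 0], [0, -1]]"

definition hadamard :: "complex mat" where
  "hadamard = complex_of_real (1 / sqrt 2) \<cdot>\<^sub>m mat_of_rows_list 2 [[1, 1], [1, -1]]"

definition s_gate :: "complex mat" where
  "s_gate = mat_of_rows_list 2 [[1, 0], [0, \<i>]]"

definition cnot_gate :: "nat \<Rightarrow> nat \<Rightarrow> nat \<Rightarrow> complex mat" where
  "cnot_gate n c t = mat (2 ^ n) (2 ^ n) (\<lambda>(x, y).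
     if x = (if bit y c then flip_bit t y else y) then 1 else 0)"

definition cz_gate :: "nat \<Rightarrow> nat \<Rightarrow> nat \<Rightarrow> complex mat" where
  "cz_gate n a b = mat (2 ^ n) (2 ^ n) (\<lambda>(x, y).
     if x = y then (if bit x a \<and> bit x b then -1 else 1) else 0)"

definition mat_exp :: "complex mat \<Rightarrow> complex mat" where
  \<comment> \<open>the exponential series of a square matrix, summed entrywise\<close>
  "mat_exp A = mat (dim_row A) (dim_row A) (\<lambda>(x, y). \<Sum>k. (A ^\<^sub>m k) $$ (x, y) / fact k)"

definition mat_sum :: "nat \<Rightarrow> ('a \<Rightarrow> complex mat) \<Rightarrow> 'a set \<Rightarrow> complex mat" where
  \<comment> \<open>the sum of a family of \<open>d \<times> d\<close> matrices; \<open>sum\<close> is not available on the type \<open>mat\<close>,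
      whose elements have varying dimensions\<close>
  "mat_sum d F I = mat d d (\<lambda>(x, y). \<Sum>k\<in>I. F k $$ (x, y))"

definition z_phase :: "nat \<Rightarrow> nat \<Rightarrow> real \<Rightarrow> complex mat" where
  "z_phase n i \<alpha> = mat_exp ((- \<i> * complex_of_real (\<alpha> / 2)) \<cdot>\<^sub>m on_qubit n i pauli_Z)"

definition gms :: "nat \<Rightarrow> nat set \<Rightarrow> real \<Rightarrow> complex mat" where
  "gms n S \<alpha> = mat_exp ((- \<i> * complex_of_real (\<alpha> / 4)) \<cdot>\<^sub>m
     mat_sum (2 ^ n) (\<lambda>(i, j). on_qubit n i pauli_X * on_qubit n j pauli_X)
       {(i, j). i \<in> S \<and> j \<in> S \<and> i \<noteq> j})"

definition is_unitary :: "complex mat \<Rightarrow> bool" where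
  "is_unitary U \<longleftrightarrow> square_mat U \<and> mat_adjoint U * U = 1\<^sub>m (dim_row U)"

definition non_clifford_angle :: "real \<Rightarrow> bool" where
  "non_clifford_angle \<alpha> \<longleftrightarrow> (\<forall>k::int. \<alpha> \<noteq> of_int k * (pi / 2))"

datatype input_gate =
    S_Gate nat
  | H_Gate nat
  | CNOT_Gate nat nat \<comment> \<open>control, target\<close>
  | CZ_Gate nat nat
  | Z_Phase nat real

fun valid_input_gate :: "nat \<Rightarrow> input_gate \<Rightarrow> bool" where
  "valid_input_gate n (S_Gate i) \<longleftrightarrow> i < n"
| "valid_input_gate n (H_Gate i) \<longleftrightarrow> i < n"
| "valid_input_gate n (CNOT_Gate c t) \<longleftrightarrow> c < n \<and> t < n \<and> c \<noteq> t"
| "valid_input_gate n (CZ_Gate a b) \<longleftrightarrow> a < n \<and> b < n \<and> a \<noteq> b"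
| "valid_input_gate n (Z_Phase i \<alpha>) \<longleftrightarrow>
     i < n \<and> \<alpha> \<in> {0..2 * pi} \<and> non_clifford_angle \<alpha>"

fun input_gate_mat :: "nat \<Rightarrow> input_gate \<Rightarrow> complex mat" where
  "input_gate_mat n (S_Gate i) = on_qubit n i s_gate"
| "input_gate_mat n (H_Gate i) = on_qubit n i hadamard"
| "input_gate_mat n (CNOT_Gate c t) = cnot_gate n c t"
| "input_gate_mat n (CZ_Gate a b) = cz_gate n a b"
| "input_gate_mat n (Z_Phase i \<alpha>) = z_phase n i \<alpha>"

fun is_z_phase :: "input_gate \<Rightarrow> bool" where
  "is_z_phase (Z_Phase i \<alpha>) \<longleftrightarrow> True"
| "is_z_phase _ \<longleftrightarrow> False"

datatype output_gate =
    Single_Qubit nat "complex mat"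
  | GMS "nat set" real

fun valid_output_gate :: "nat \<Rightarrow> output_gate \<Rightarrow> bool" where
  "valid_output_gate n (Single_Qubit i U) \<longleftrightarrow> i < n \<and> U \<in> carrier_mat 2 2 \<and> is_unitary U"
| "valid_output_gate n (GMS S \<alpha>) \<longleftrightarrow> S \<subseteq> {..<n}"

fun output_gate_mat :: "nat \<Rightarrow> output_gate \<Rightarrow> complex mat" where
  "output_gate_mat n (Single_Qubit i U) = on_qubit n i U"
| "output_gate_mat n (GMS S \<alpha>) = gms n S \<alpha>"

fun is_gms :: "output_gate \<Rightarrow> bool" where
  "is_gms (GMS S \<alpha>) \<longleftrightarrow> True"
| "is_gms _ \<longleftrightarrow> False"

definition circuit_mat :: "nat \<Rightarrow> (nat \<Rightarrow> 'g \<Rightarrow> complex mat) \<Rightarrow> 'g list \<Rightarrow> complex mat" where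
  \<comment> \<open>a circuit lists its gates in order of application, so later gates multiply from the left\<close>
  "circuit_mat n m gs = fold (\<lambda>g M. m n g * M) gs (1\<^sub>m (2 ^ n))"

definition input_circuit :: "nat \<Rightarrow> input_gate list \<Rightarrow> bool" where
  "input_circuit n C \<longleftrightarrow> (\<forall>g\<in>set C. valid_input_gate n g)"

definition output_circuit :: "nat \<Rightarrow> output_gate list \<Rightarrow> bool" where
  "output_circuit n D \<longleftrightarrow> (\<forall>g\<in>set D. valid_output_gate n g)"

definition equal_up_to_global_phase :: "complex mat \<Rightarrow> complex mat \<Rightarrow> bool" where
  "equal_up_to_global_phase A B \<longleftrightarrow> (\<exists>\<phi>::real. A = cis \<phi> \<cdot>\<^sub>m B)"

end

theory Submission
  imports Defs
begin

text \<open>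
  Write \<open>rot A = (1 + A) / sqrt 2\<close> for an antihermitian Pauli operator \<open>A\<close>. The spectrum of a clique
  of \<open>XX\<close> interactions at angle \<open>\<pi>/2\<close> shows that the GMS gate on \<open>S\<close> equals, up to single-qubit gates,
  the rotation \<open>rot A\<close> with \<open>A = \<i> Z\<^sub>S\<close>, so every \<open>rot A\<close> costs one GMS gate. If \<open>T\<close> and \<open>P\<close> are anticommuting
  hermitian Pauli operators, then \<open>rot (T P)\<close> conjugates \<open>P\<close> to exactly \<open>T\<close>.

  Consequently a phase gate following a Clifford operation \<open>K\<close>, that is \<open>K exp(-i \<alpha>/2 P)\<close> with
  \<open>P = K\<^sup>-\<^sup>1 Z\<^sub>i K\<close>, becomes \<open>K W\<^sup>-\<^sup>1\<close> times a single-qubit rotation times \<open>W\<close>, where \<open>W\<close> is one \<open>rot\<close>; the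
  factor \<open>W\<^sup>-\<^sup>1\<close> is absorbed into the Clifford part. So \<open>N\<close> phase gates cost \<open>N\<close> GMS gates and leave one
  Clifford operation. That operation is reduced qubit by qubit: two rotations restore \<open>Z\<^sub>k\<close>, through an
  intermediate Pauli operator anticommuting with both ends, and a third one restores \<open>X\<^sub>k\<close> while fixing
  \<open>Z\<^sub>k\<close>. What remains on the last qubit is a single-qubit gate, so \<open>3 (n - 1)\<close> GMS gates suffice, which
  is at most \<open>6 n - 8\<close> for \<open>n \<ge> 2\<close>. For \<open>n \<le> 1\<close>, where \<open>N + 6 n - 8\<close> may truncate to 0, no GMS gate is needed.
\<close>

lemma sum_delta_mult:
  fixes c g :: "nat \<Rightarrow> complex"
  assumes "a < m"
  shows "(\<Sum>k<m. (if k = a then c k else 0) * g k) = c a * g a"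
    "(\<Sum>k<m. (if a = k then c k else 0) * g k) = c a * g a"
    "(\<Sum>k<m. g k * (if k = a then c k else 0)) = g a * c a"
    "(\<Sum>k<m. g k * (if a = k then c k else 0)) = g a * c a"
  using assms by (simp_all add: if_distrib[of "\<lambda>z. z * _"] if_distrib[of "(*) _"] cong: if_cong)

section \<open>Square matrices of a fixed size\<close>

text \<open>Products stay opaque to simp: entries and reassociation enter only through
  \<open>index_mult\<close>, \<open>assoc\<close> and \<open>expand\<close>.\<close>

declare assoc_mult_mat [simp del] index_mult_mat(1) [simp del]

text \<open>With the dimension fixed, every carrier condition has the form \<open>A \<in> M\<close>,
  which the simp rules \<open>closed\<close> discharge.\<close>

locale square =
  fixes d :: nat
begin

abbreviation M :: "complex mat set" where "M \<equiv> carrier_mat d d"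

lemma index_mult: "A \<in> M \<Longrightarrow> B \<in> M \<Longrightarrow> i < d \<Longrightarrow> j < d \<Longrightarrow>
    (A * B) $$ (i, j) = (\<Sum>k<d. A $$ (i, k) * B $$ (k, j))"
  by (simp add: index_mult_mat(1) scalar_prod_def atLeast0LessThan)

lemma index_adjoint: "A \<in> M \<Longrightarrow> i < d \<Longrightarrow> j < d \<Longrightarrow> mat_adjoint A $$ (i, j) = cnj (A $$ (j, i))"
  by (simp add: mat_adjoint_def mat_of_rows_index)

lemma adjoint_closed: "A \<in> M \<Longrightarrow> mat_adjoint A \<in> M"
  by (auto simp: mat_adjoint_def)

lemma closed [simp]:
  "1\<^sub>m d \<in> M"
  "A \<in> M \<Longrightarrow> B \<in> M \<Longrightarrow> A * B \<in> M"
  "A \<in> M \<Longrightarrow> B \<in> M \<Longrightarrow> A + B \<in> M"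
  "A \<in> M \<Longrightarrow> c \<cdot>\<^sub>m A \<in> M"
  "A \<in> M \<Longrightarrow> mat_adjoint A \<in> M"
  by (auto intro: adjoint_closed)

lemma index [simp]:
  "A \<in> M \<Longrightarrow> B \<in> M \<Longrightarrow> i < d \<Longrightarrow> j < d \<Longrightarrow> (A + B) $$ (i, j) = A $$ (i, j) + B $$ (i, j)"
  "A \<in> M \<Longrightarrow> i < d \<Longrightarrow> j < d \<Longrightarrow> (c \<cdot>\<^sub>m A) $$ (i, j) = c * A $$ (i, j)"
  by auto

lemma eqI: "A \<in> M \<Longrightarrow> B \<in> M \<Longrightarrow> (\<And>i j. i < d \<Longrightarrow> j < d \<Longrightarrow> A $$ (i, j) = B $$ (i, j)) \<Longrightarrow> A = B"
  by (rule eq_matI) auto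

lemma assoc: "A \<in> M \<Longrightarrow> B \<in> M \<Longrightarrow> C \<in> M \<Longrightarrow> A * B * C = A * (B * C)"
  by (rule assoc_mult_mat)

text \<open>As rewrite rules these turn a matrix expression into a sum of scaled, right-nested
  products. Single rules are selected by number where full distribution would go too far.\<close>

lemma expand:
  fixes A B C :: "complex mat"
  shows "A \<in> M \<Longrightarrow> B \<in> M \<Longrightarrow> C \<in> M \<Longrightarrow> A * B * C = A * (B * C)"
    "A \<in> M \<Longrightarrow> B \<in> M \<Longrightarrow> C \<in> M \<Longrightarrow> (A + B) * C = A * C + B * C"
    "A \<in> M \<Longrightarrow> B \<in> M \<Longrightarrow> C \<in> M \<Longrightarrow> A * (B + C) = A * B + A * C"
    "A \<in> M \<Longrightarrow> B \<in> M \<Longrightarrow> (c \<cdot>\<^sub>m A) * B = c \<cdot>\<^sub>m (A * B)"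
    "A \<in> M \<Longrightarrow> B \<in> M \<Longrightarrow> A * (c \<cdot>\<^sub>m B) = c \<cdot>\<^sub>m (A * B)"
    "A \<in> M \<Longrightarrow> B \<in> M \<Longrightarrow> c \<cdot>\<^sub>m (A + B) = c \<cdot>\<^sub>m A + c \<cdot>\<^sub>m B"
    "A \<in> M \<Longrightarrow> a \<cdot>\<^sub>m (b \<cdot>\<^sub>m A) = (a * b) \<cdot>\<^sub>m A"
    "A \<in> M \<Longrightarrow> 1\<^sub>m d * A = A"
    "A \<in> M \<Longrightarrow> A * 1\<^sub>m d = A"
    "A \<in> M \<Longrightarrow> 1 \<cdot>\<^sub>m A = A"
  by (simp_all add: assoc_mult_mat[of _ d d _ d _ d] add_mult_distrib_mat[of _ d d _ _ d]
      mult_add_distrib_mat[of _ d d _ d] mult_smult_assoc_mat[of _ d d _ d]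
      mult_smult_distrib[of _ d d _ d] add_smult_distrib_left_mat[of _ d d])
    (auto intro!: eq_matI)

lemma adjoint:
  "A \<in> M \<Longrightarrow> B \<in> M \<Longrightarrow> mat_adjoint (A * B) = mat_adjoint B * mat_adjoint A"
  "A \<in> M \<Longrightarrow> B \<in> M \<Longrightarrow> mat_adjoint (A + B) = mat_adjoint A + mat_adjoint B"
  "A \<in> M \<Longrightarrow> mat_adjoint (c \<cdot>\<^sub>m A) = cnj c \<cdot>\<^sub>m mat_adjoint A"
  "A \<in> M \<Longrightarrow> mat_adjoint (mat_adjoint A) = A"
  "mat_adjoint (1\<^sub>m d :: complex mat) = 1\<^sub>m d"
proof -
  assume A: "A \<in> M"
  {
    assume B: "B \<in> M"
    show "mat_adjoint (A * B) = mat_adjoint B * mat_adjoint A"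
      using A B by (intro eqI) (auto simp: index_adjoint index_mult mult.commute intro!: sum.cong)
    show "mat_adjoint (A + B) = mat_adjoint A + mat_adjoint B"
      using A B closed by (intro eqI) (auto simp: index_adjoint)
  }
  show "mat_adjoint (c \<cdot>\<^sub>m A) = cnj c \<cdot>\<^sub>m mat_adjoint A" "mat_adjoint (mat_adjoint A) = A"
    using A adjoint_closed[OF A] by (intro eqI; auto simp: index_adjoint)+
next
  show "mat_adjoint (1\<^sub>m d :: complex mat) = 1\<^sub>m d"
    by (intro eqI) (auto simp: index_adjoint)
qed

section \<open>Unitary matrices, commutation up to a sign, and conjugation\<close>

definition unitary :: "complex mat \<Rightarrow> bool" where
  "unitary A \<longleftrightarrow> A \<in> M \<and> mat_adjoint A * A = 1\<^sub>m d \<and> A * mat_adjoint A = 1\<^sub>m d"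

text \<open>A left inverse of a square matrix is also a right inverse.\<close>

lemma unitaryI: "A \<in> M \<Longrightarrow> mat_adjoint A * A = 1\<^sub>m d \<Longrightarrow> unitary A"
  unfolding unitary_def by (simp add: mat_mult_left_right_inverse[of "mat_adjoint A" d A])

lemma unitary_closed [simp]: "unitary A \<Longrightarrow> A \<in> M"
  by (simp add: unitary_def)

lemma unitary_cancel:
  assumes "unitary A"
  shows "mat_adjoint A * A = 1\<^sub>m d" "A * mat_adjoint A = 1\<^sub>m d"
    "B \<in> M \<Longrightarrow> mat_adjoint A * (A * B) = B" "B \<in> M \<Longrightarrow> A * (mat_adjoint A * B) = B"
proof -
  show *: "mat_adjoint A * A = 1\<^sub>m d" "A * mat_adjoint A = 1\<^sub>m d"
    using assms by (auto simp: unitary_def)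
  assume "B \<in> M"
  with assms * show "mat_adjoint A * (A * B) = B" "A * (mat_adjoint A * B) = B"
    by (simp_all flip: assoc add: expand(8))
qed

lemma unitary_mult: "unitary A \<Longrightarrow> unitary B \<Longrightarrow> unitary (A * B)"
  by (rule unitaryI) (simp_all add: adjoint assoc unitary_cancel)

lemma unitary_adjoint: "unitary A \<Longrightarrow> unitary (mat_adjoint A)"
  by (simp add: unitary_def adjoint)

lemma unitary_smult:
  assumes "unitary A" "cmod c = 1"
  shows "unitary (c \<cdot>\<^sub>m A)"
proof (rule unitaryI)
  have "c * cnj c = 1"
    using assms(2) by (metis complex_norm_square of_real_1 power_one)
  then show "mat_adjoint (c \<cdot>\<^sub>m A) * (c \<cdot>\<^sub>m A) = 1\<^sub>m d"
    using assms(1) by (simp add: adjoint expand unitary_cancel mult.commute)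
qed (use assms in simp)

lemma unitary_one: "unitary (1\<^sub>m d)"
  by (rule unitaryI) (simp_all add: adjoint)

text \<open>Pauli operators satisfy this with \<epsilon> equal to 1 or -1. Keeping the sign as a
  parameter treats commuting and anticommuting operators alike; under products the signs
  multiply.\<close>

definition twist :: "complex \<Rightarrow> complex mat \<Rightarrow> complex mat \<Rightarrow> bool" where
  "twist \<epsilon> A B \<longleftrightarrow> A * B = \<epsilon> \<cdot>\<^sub>m (B * A)"

abbreviation "comm \<equiv> twist 1"
abbreviation "anti \<equiv> twist (- 1)"

lemma comm_iff: "A \<in> M \<Longrightarrow> B \<in> M \<Longrightarrow> comm A B \<longleftrightarrow> A * B = B * A"
  by (simp add: twist_def expand)

lemma twist_mult:
  assumes "A \<in> M" "B \<in> M" "C \<in> M" "twist \<epsilon> A B" "twist \<delta> A C"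
  shows "twist (\<epsilon> * \<delta>) A (B * C)"
proof -
  have "A * (B * C) = (A * B) * C"
    using assms by (simp add: assoc)
  also have "\<dots> = \<epsilon> \<cdot>\<^sub>m (B * (A * C))"
    using assms by (simp add: twist_def expand)
  also have "\<dots> = \<epsilon> * \<delta> \<cdot>\<^sub>m (B * C * A)"
    using assms by (simp add: twist_def expand)
  finally show ?thesis
    using assms by (simp add: twist_def)
qed

lemma twist_sym:
  assumes "A \<in> M" "B \<in> M" "twist \<epsilon> A B" "\<epsilon> * \<epsilon> = 1"
  shows "twist \<epsilon> B A"
  using assms by (simp add: twist_def expand)

lemma twist_mult_left:
  assumes "A \<in> M" "B \<in> M" "C \<in> M" "twist \<epsilon> B A" "twist \<delta> C A" "\<epsilon> * \<epsilon> = 1" "\<delta> * \<delta> = 1"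
  shows "twist (\<epsilon> * \<delta>) (B * C) A"
proof -
  have "twist (\<epsilon> * \<delta>) A (B * C)"
    using assms by (intro twist_mult) (simp_all add: twist_sym)
  then show ?thesis
    by (rule twist_sym[rotated 2]) (use assms in \<open>auto simp: mult_ac\<close>)
qed

lemma twist_smult: "A \<in> M \<Longrightarrow> B \<in> M \<Longrightarrow> twist \<epsilon> A B \<Longrightarrow> twist \<epsilon> A (c \<cdot>\<^sub>m B)"
  by (simp add: twist_def expand mult.commute)

lemma twist_smult_left: "A \<in> M \<Longrightarrow> B \<in> M \<Longrightarrow> twist \<epsilon> A B \<Longrightarrow> twist \<epsilon> (c \<cdot>\<^sub>m A) B"
  by (simp add: twist_def expand mult.commute)

lemma comm_add_left: "A \<in> M \<Longrightarrow> B \<in> M \<Longrightarrow> C \<in> M \<Longrightarrow> comm A C \<Longrightarrow> comm B C \<Longrightarrow> comm (A + B) C"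
  by (simp add: comm_iff expand)

lemma comm_one: "A \<in> M \<Longrightarrow> comm (1\<^sub>m d) A"
  by (simp add: twist_def expand)

lemma comm_adjoint:
  assumes "unitary K" "A \<in> M" "comm K A"
  shows "comm (mat_adjoint K) A"
proof -
  have "mat_adjoint K * A = mat_adjoint K * (A * K) * mat_adjoint K"
    using assms by (simp add: assoc unitary_cancel expand)
  also have "\<dots> = mat_adjoint K * (K * A) * mat_adjoint K"
    using assms by (simp add: comm_iff)
  also have "\<dots> = A * mat_adjoint K"
    using assms by (simp add: unitary_cancel)
  finally show ?thesis
    using assms by (simp add: comm_iff)
qed

text \<open>The inverse stands on the left, so that \<open>K * conj K A = A * K\<close>: an operator
  \<open>A\<close> applied after \<open>K\<close> becomes \<open>conj K A\<close> applied before
  \<open>K\<close>.\<close>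

definition conj :: "complex mat \<Rightarrow> complex mat \<Rightarrow> complex mat" where
  "conj K A = mat_adjoint K * (A * K)"

lemma conj_closed [simp]: "unitary K \<Longrightarrow> A \<in> M \<Longrightarrow> conj K A \<in> M"
  by (simp add: conj_def)

lemma conj_eq: "unitary K \<Longrightarrow> A \<in> M \<Longrightarrow> K * conj K A = A * K"
  by (simp add: conj_def unitary_cancel)

lemma conj_eqI: "unitary K \<Longrightarrow> A \<in> M \<Longrightarrow> B \<in> M \<Longrightarrow> K * B = A * K \<Longrightarrow> conj K A = B"
  by (metis conj_def unitary_cancel(3))

lemma conj_mult: "unitary K \<Longrightarrow> A \<in> M \<Longrightarrow> B \<in> M \<Longrightarrow> conj K (A * B) = conj K A * conj K B"
  by (simp add: conj_def assoc unitary_cancel)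

lemma conj_smult: "unitary K \<Longrightarrow> A \<in> M \<Longrightarrow> conj K (c \<cdot>\<^sub>m A) = c \<cdot>\<^sub>m conj K A"
  by (simp add: conj_def expand)

lemma conj_compose: "unitary K \<Longrightarrow> unitary L \<Longrightarrow> A \<in> M \<Longrightarrow> conj (K * L) A = conj L (conj K A)"
  by (simp add: conj_def adjoint assoc)

lemma conj_adjoint: "unitary K \<Longrightarrow> A \<in> M \<Longrightarrow> mat_adjoint (conj K A) = conj K (mat_adjoint A)"
  by (simp add: conj_def adjoint assoc)

lemma twist_conj: "unitary K \<Longrightarrow> A \<in> M \<Longrightarrow> B \<in> M \<Longrightarrow> twist \<epsilon> A B \<Longrightarrow> twist \<epsilon> (conj K A) (conj K B)"
  by (metis twist_def conj_mult conj_smult closed(2))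

lemma conj_comm: "unitary K \<Longrightarrow> A \<in> M \<Longrightarrow> comm K A \<Longrightarrow> conj K A = A"
  by (rule conj_eqI) (auto simp: comm_iff)

subsection \<open>Quarter-turn rotations\<close>

text \<open>If \<open>A * A\<close> is minus the identity, this is exp((pi/4) A).\<close>

definition rot :: "complex mat \<Rightarrow> complex mat" where
  "rot A = complex_of_real (1 / sqrt 2) \<cdot>\<^sub>m (1\<^sub>m d + A)"

lemma rot_closed [simp]: "A \<in> M \<Longrightarrow> rot A \<in> M"
  by (simp add: rot_def)

lemma half_sqrt: "complex_of_real (1 / sqrt 2) * complex_of_real (1 / sqrt 2) = 1 / 2"
  by (simp flip: of_real_mult)

lemma unitary_rot:
  assumes "unitary A" "mat_adjoint A = (- 1) \<cdot>\<^sub>m A"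
  shows "unitary (rot A)"
proof (rule unitaryI)
  have A: "A \<in> M" using assms by simp
  have "(- 1) \<cdot>\<^sub>m (A * A) = 1\<^sub>m d"
    using unitary_cancel(1)[OF assms(1)] A by (simp add: assms(2) expand)
  \<comment> \<open>Negating twice turns - A A = 1 into A A = -1, whence (1 - A)(1 + A) = 1 - A A =
    2.\<close>
  moreover have "A * A = (- 1) \<cdot>\<^sub>m ((- 1) \<cdot>\<^sub>m (A * A))"
    using A by (simp add: expand)
  ultimately have "A * A = (- 1) \<cdot>\<^sub>m 1\<^sub>m d"
    by simp
  then show "mat_adjoint (rot A) * rot A = 1\<^sub>m d"
    using A half_sqrt by (simp add: rot_def adjoint expand assms(2)) (auto intro!: eqI simp: field_simps)
qed (use assms in simp)

lemma rot_comm: "A \<in> M \<Longrightarrow> B \<in> M \<Longrightarrow> comm A B \<Longrightarrow> comm (rot A) B"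
  unfolding rot_def by (intro twist_smult_left comm_add_left comm_one) auto

text \<open>An antihermitian unitary satisfies A A = -1, so (1 + A)(- A B) = B - A B = B (1 +
  A).\<close>

lemma rot_anti:
  assumes "unitary A" "B \<in> M" "mat_adjoint A = (- 1) \<cdot>\<^sub>m A" "anti A B"
  shows "conj (rot A) B = (- 1) \<cdot>\<^sub>m (A * B)"
proof (rule conj_eqI)
  have A: "A \<in> M" using assms by simp
  have AA: "mat_adjoint A * (A * B) = B"
    using unitary_cancel(3)[OF assms(1,2)] .
  then have "(- 1) \<cdot>\<^sub>m (A * (A * B)) = B"
    using A assms by (simp add: expand)
  moreover have "A * (A * B) = (- 1) \<cdot>\<^sub>m ((- 1) \<cdot>\<^sub>m (A * (A * B)))"
    using A assms(2) by (simp add: expand)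
  ultimately have "A * (A * B) = (- 1) \<cdot>\<^sub>m B"
    by simp
  moreover have BA: "B * A = (- 1) \<cdot>\<^sub>m (A * B)"
    using assms A by (simp add: twist_def expand)
  ultimately show "rot A * ((- 1) \<cdot>\<^sub>m (A * B)) = B * rot A"
    using A assms by (simp add: rot_def expand) (auto intro!: eqI simp: field_simps)
qed (use assms unitary_rot in auto)

definition hermitian :: "complex mat \<Rightarrow> bool" where
  "hermitian A \<longleftrightarrow> mat_adjoint A = A"

lemma hermitian_conj: "unitary K \<Longrightarrow> A \<in> M \<Longrightarrow> hermitian A \<Longrightarrow> hermitian (conj K A)"
  by (simp add: hermitian_def conj_adjoint)

lemma hermitian_anti:
  assumes "A \<in> M" "B \<in> M" "hermitian A" "hermitian B" "anti A B"
  shows "mat_adjoint (A * B) = (- 1) \<cdot>\<^sub>m (A * B)"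
  using assms by (simp add: hermitian_def adjoint twist_def expand)

text \<open>Both sides equal (T + P) / sqrt 2, because T T = 1 and P P = 1.\<close>

lemma rot_exchange:
  assumes "unitary T" "unitary P" "hermitian T" "hermitian P"
  shows "rot (T * P) * P = T * rot (T * P)"
proof -
  have T: "T \<in> M" "P \<in> M" using assms by auto
  have "T * (T * P) = P" "P * P = 1\<^sub>m d"
    using unitary_cancel(3)[of T P] unitary_cancel(1)[of P] assms by (auto simp: hermitian_def)
  with T show ?thesis
    by (simp add: rot_def expand) (auto intro!: eqI)
qed

end

section \<open>Tensor products\<close>

lemma bit_less_exp: "x < 2 ^ n \<Longrightarrow> bit x i \<Longrightarrow> i < n" for x :: nat
proof (rule ccontr)
  assume "x < 2 ^ n" "bit x i" "\<not> i < n"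
  then have "x < 2 ^ i"
    by (meson le_less_trans less_le_not_le not_less order_less_le_trans power_increasing one_le_numeral)
  with \<open>bit x i\<close> show False
    by (simp add: bit_iff_odd)
qed

lemma bits_eqI: "x < 2 ^ n \<Longrightarrow> y < 2 ^ n \<Longrightarrow> (\<And>i. i < n \<Longrightarrow> bit x i = bit y i) \<Longrightarrow> x = y" for x y :: nat
  by (rule bit_eqI) (use bit_less_exp in blast)

lemma bit_add_exp:
  fixes z :: nat
  assumes "z < 2 ^ n"
  shows "i < n \<Longrightarrow> bit (z + 2 ^ n) i = bit z i" "bit (z + 2 ^ n) n"
proof -
  assume "i < n"
  \<comment> \<open>As \<open>i < n\<close>, the summand \<open>2 ^ n\<close> is an even multiple of
    \<open>2 ^ i\<close> and does not affect the parity of the quotient.\<close>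
  then have "2 ^ n = 2 * 2 ^ (n - Suc i) * (2 ^ i :: nat)"
    by (simp flip: power_add power_Suc add: Suc_diff_Suc)
  then have "(z + 2 ^ n) div 2 ^ i = 2 * 2 ^ (n - Suc i) + z div 2 ^ i"
    by (simp only: div_mult_self1) simp
  then show "bit (z + 2 ^ n) i = bit z i"
    by (simp add: bit_iff_odd)
next
  show "bit (z + 2 ^ n) n"
    using assms by (simp add: bit_iff_odd)
qed

text \<open>Distributivity for a product of two-term sums: the bits of \<open>z\<close> record which
  term is chosen in each factor. The induction splits the indices by their top bit into
  \<open>z\<close> and \<open>z + 2 ^ n\<close>.\<close>

lemma sum_prod_bits:
  fixes f :: "nat \<Rightarrow> bool \<Rightarrow> complex"
  shows "(\<Sum>z<2 ^ n :: nat. \<Prod>i<n. f i (bit z i)) = (\<Prod>i<n. f i False + f i True)"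
proof (induction n)
  case (Suc n)
  let ?g = "\<lambda>m z. \<Prod>i<m. f i (bit z i)"
  have "(\<Sum>z<2 ^ Suc n :: nat. ?g (Suc n) z) = (\<Sum>z<2 ^ n :: nat. ?g (Suc n) z) + (\<Sum>z<2 ^ n :: nat. ?g (Suc n) (z + 2 ^ n))"
  proof -
    have "{..<2 ^ Suc n} = {..<2 ^ n} \<union> {2 ^ n..<2 ^ n + 2 ^ n :: nat}"
      by auto
    moreover have "(\<Sum>z\<in>{2 ^ n..<2 ^ n + 2 ^ n :: nat}. ?g (Suc n) z) = (\<Sum>z<2 ^ n :: nat. ?g (Suc n) (z + 2 ^ n))"
      using sum.shift_bounds_nat_ivl[of "?g (Suc n)" 0 "2 ^ n" "2 ^ n"] by (simp add: atLeast0LessThan)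
    ultimately show ?thesis
      by (simp add: sum.union_disjoint ivl_disj_int)
  qed
  also have "(\<Sum>z<2 ^ n :: nat. ?g (Suc n) z) = (\<Sum>z<2 ^ n :: nat. ?g n z) * f n False"
    unfolding sum_distrib_right prod.lessThan_Suc
    using bit_less_exp[of _ n n] by (intro sum.cong refl arg_cong2[of _ _ _ _ "(*)"] arg_cong[of _ _ "f n"]) auto
  also have "(\<Sum>z<2 ^ n :: nat. ?g (Suc n) (z + 2 ^ n)) = (\<Sum>z<2 ^ n :: nat. ?g n z) * f n True"
    unfolding sum_distrib_right
    by (intro sum.cong refl) (simp add: bit_add_exp)
  finally show ?case
    by (simp add: Suc.IH distrib_left)
qed simp

interpretation q1: square 2 .

locale qubits =
  fixes n :: nat

sublocale qubits \<subseteq> square "2 ^ n" .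

definition tensor :: "nat \<Rightarrow> (nat \<Rightarrow> complex mat) \<Rightarrow> complex mat" where
  "tensor n u = mat (2 ^ n) (2 ^ n) (\<lambda>(x, y). \<Prod>i<n. u i $$ (of_bool (bit x i), of_bool (bit y i)))"

lemma of_bool_less_2 [simp]: "of_bool b < (2 :: nat)"
  by (cases b) auto

lemma sum_lessThan_2: "(\<Sum>k<2. f k) = f 0 + f (1 :: nat)"
  by (simp add: numeral_2_eq_2)

definition single :: "nat \<Rightarrow> complex mat \<Rightarrow> nat \<Rightarrow> complex mat" where
  "single i A = (\<lambda>j. if j = i then A else 1\<^sub>m 2)"

context qubits
begin

lemma tensor_closed [simp]: "tensor n u \<in> M"
  by (simp add: tensor_def)

lemma tensor_index: "x < 2 ^ n \<Longrightarrow> y < 2 ^ n \<Longrightarrow>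
    tensor n u $$ (x, y) = (\<Prod>i<n. u i $$ (of_bool (bit x i), of_bool (bit y i)))"
  by (simp add: tensor_def)

lemma tensor_cong: "(\<And>i. i < n \<Longrightarrow> u i = v i) \<Longrightarrow> tensor n u = tensor n v"
  by (auto simp: tensor_def intro!: cong_mat prod.cong)

lemma tensor_mult:
  assumes "\<And>i. i < n \<Longrightarrow> u i \<in> carrier_mat 2 2" "\<And>i. i < n \<Longrightarrow> v i \<in> carrier_mat 2 2"
  shows "tensor n u * tensor n v = tensor n (\<lambda>i. u i * v i)"
proof (rule eqI)
  fix x y :: nat assume xy: "x < 2 ^ n" "y < 2 ^ n"
  have "(tensor n u * tensor n v) $$ (x, y) =
      (\<Sum>z<2 ^ n :: nat. \<Prod>i<n. u i $$ (of_bool (bit x i), of_bool (bit z i)) * v i $$ (of_bool (bit z i), of_bool (bit y i)))"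
    using xy by (simp add: index_mult tensor_index prod.distrib)
  also have "\<dots> = tensor n (\<lambda>i. u i * v i) $$ (x, y)"
    using xy assms
    by (subst sum_prod_bits) (simp add: tensor_index q1.index_mult sum_lessThan_2)
  finally show "(tensor n u * tensor n v) $$ (x, y) = tensor n (\<lambda>i. u i * v i) $$ (x, y)" .
qed auto

lemma tensor_smult:
  assumes "\<And>i. i < n \<Longrightarrow> u i \<in> carrier_mat 2 2"
  shows "tensor n (\<lambda>i. c i \<cdot>\<^sub>m u i) = (\<Prod>i<n. c i) \<cdot>\<^sub>m tensor n u"
proof (rule eqI)
  fix x y :: nat assume xy: "x < 2 ^ n" "y < 2 ^ n"
  have "tensor n (\<lambda>i. c i \<cdot>\<^sub>m u i) $$ (x, y) =
      (\<Prod>i<n. c i * u i $$ (of_bool (bit x i), of_bool (bit y i)))"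
    unfolding tensor_index[OF xy] using assms by (intro prod.cong) auto
  then show "tensor n (\<lambda>i. c i \<cdot>\<^sub>m u i) $$ (x, y) = ((\<Prod>i<n. c i) \<cdot>\<^sub>m tensor n u) $$ (x, y)"
    using xy by (simp add: tensor_index prod.distrib)
qed auto

lemma tensor_adjoint:
  assumes "\<And>i. i < n \<Longrightarrow> u i \<in> carrier_mat 2 2"
  shows "mat_adjoint (tensor n u) = tensor n (\<lambda>i. mat_adjoint (u i))"
  using assms
  by (intro eqI)
    (auto simp: index_adjoint tensor_index q1.index_adjoint intro!: prod.cong)

lemma tensor_one: "tensor n (\<lambda>i. 1\<^sub>m 2) = 1\<^sub>m (2 ^ n)"
proof (rule eqI)
  fix x y :: nat assume xy: "x < 2 ^ n" "y < 2 ^ n"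
  have "x \<noteq> y \<Longrightarrow> \<exists>i<n. bit x i \<noteq> bit y i"
    using xy bits_eqI by blast
  then show "tensor n (\<lambda>i. 1\<^sub>m 2) $$ (x, y) = 1\<^sub>m (2 ^ n) $$ (x, y)"
    using xy by (auto simp: tensor_index intro!: prod_zero)
qed auto

lemma on_qubit_closed [simp]: "on_qubit n i A \<in> M"
  by (simp add: on_qubit_def)

lemma on_qubit_index: "x < 2 ^ n \<Longrightarrow> y < 2 ^ n \<Longrightarrow>
    on_qubit n i A $$ (x, y) =
      (if \<forall>j<n. j \<noteq> i \<longrightarrow> bit x j = bit y j then A $$ (of_bool (bit x i), of_bool (bit y i)) else 0)"
  by (simp add: on_qubit_def)

lemma on_qubit_tensor:
  assumes "i < n"
  shows "on_qubit n i A = tensor n (single i A)"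
proof (rule eqI)
  fix x y :: nat assume xy: "x < 2 ^ n" "y < 2 ^ n"
  have "tensor n (single i A) $$ (x, y) =
      A $$ (of_bool (bit x i), of_bool (bit y i)) *
      (\<Prod>j\<in>{..<n} - {i}. 1\<^sub>m 2 $$ (of_bool (bit x j), of_bool (bit y j)))"
    using xy assms by (simp add: tensor_index prod.remove[of _ i] single_def)
  \<comment> \<open>A single disagreeing bit contributes an off-diagonal entry of the identity,
    which is 0.\<close>
  also have "(\<Prod>j\<in>{..<n} - {i}. 1\<^sub>m 2 $$ (of_bool (bit x j), of_bool (bit y j))) =
      (if \<forall>j<n. j \<noteq> i \<longrightarrow> bit x j = bit y j then 1 else 0 :: complex)"
    by (auto intro!: prod_zero)
  finally show "on_qubit n i A $$ (x, y) = tensor n (single i A) $$ (x, y)"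
    using xy by (auto simp: on_qubit_index)
qed auto

lemma on_qubit_mult:
  assumes "i < n" "A \<in> carrier_mat 2 2" "B \<in> carrier_mat 2 2"
  shows "on_qubit n i A * on_qubit n i B = on_qubit n i (A * B)"
  using assms by (simp add: on_qubit_tensor tensor_mult single_def) (auto intro!: tensor_cong)

lemma on_qubit_one: "i < n \<Longrightarrow> on_qubit n i (1\<^sub>m 2) = 1\<^sub>m (2 ^ n)"
  by (simp add: on_qubit_tensor single_def tensor_one)

lemma on_qubit_add:
  assumes "A \<in> carrier_mat 2 2" "B \<in> carrier_mat 2 2"
  shows "on_qubit n i (A + B) = on_qubit n i A + on_qubit n i B"
  using assms by (intro eqI) (auto simp: on_qubit_index)

lemma on_qubit_smult:
  assumes "A \<in> carrier_mat 2 2"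
  shows "on_qubit n i (c \<cdot>\<^sub>m A) = c \<cdot>\<^sub>m on_qubit n i A"
  using assms by (intro eqI) (auto simp: on_qubit_index)

lemma on_qubit_adjoint:
  assumes "A \<in> carrier_mat 2 2"
  shows "mat_adjoint (on_qubit n i A) = on_qubit n i (mat_adjoint A)"
  using assms
  by (intro eqI)
    (auto simp: on_qubit_index index_adjoint q1.index_adjoint)

lemma tensor_unitary:
  assumes "\<And>i. i < n \<Longrightarrow> q1.unitary (u i)"
  shows "unitary (tensor n u)"
proof (rule unitaryI)
  have "tensor n (\<lambda>i. mat_adjoint (u i) * u i) = tensor n (\<lambda>i. 1\<^sub>m 2)"
    using assms by (intro tensor_cong) (simp add: q1.unitary_cancel)
  then show "mat_adjoint (tensor n u) * tensor n u = 1\<^sub>m (2 ^ n)"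
    using assms by (simp add: tensor_adjoint tensor_mult tensor_one)
qed simp

end

section \<open>The Pauli group\<close>

text \<open>Together with \<open>anti2\<close> these are closed under products, scalars and
  adjoints, so that one-qubit Pauli calculus reduces to identities between complex numbers.\<close>

definition diag2 :: "complex \<Rightarrow> complex \<Rightarrow> complex mat" where
  "diag2 a b = mat 2 2 (\<lambda>(x, y). if x = y then if x = 0 then a else b else 0)"

definition anti2 :: "complex \<Rightarrow> complex \<Rightarrow> complex mat" where
  "anti2 a b = mat 2 2 (\<lambda>(x, y). if x = y then 0 else if x = 0 then a else b)"

lemma closed2 [simp]: "diag2 a b \<in> carrier_mat 2 2" "anti2 a b \<in> carrier_mat 2 2"
  by (simp_all add: diag2_def anti2_def)

lemma index2 [simp]:
  "diag2 a b $$ (0, 0) = a" "diag2 a b $$ (0, Suc 0) = 0" "diag2 a b $$ (Suc 0, 0) = 0" "diag2 a b $$ (Suc 0, Suc 0) = b"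
  "anti2 a b $$ (0, 0) = 0" "anti2 a b $$ (0, Suc 0) = a" "anti2 a b $$ (Suc 0, 0) = b" "anti2 a b $$ (Suc 0, Suc 0) = 0"
  by (simp_all add: diag2_def anti2_def)

lemma eqI2:
  fixes A B :: "complex mat"
  assumes "A \<in> carrier_mat 2 2" "B \<in> carrier_mat 2 2"
    "A $$ (0, 0) = B $$ (0, 0)" "A $$ (0, Suc 0) = B $$ (0, Suc 0)"
    "A $$ (Suc 0, 0) = B $$ (Suc 0, 0)" "A $$ (Suc 0, Suc 0) = B $$ (Suc 0, Suc 0)"
  shows "A = B"
  using assms by (intro q1.eqI) (auto simp: less_2_cases_iff)

lemma mult2:
  "diag2 a b * diag2 c e = diag2 (a * c) (b * e)"
  "diag2 a b * anti2 c e = anti2 (a * c) (b * e)"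
  "anti2 a b * diag2 c e = anti2 (a * e) (b * c)"
  "anti2 a b * anti2 c e = diag2 (a * e) (b * c)"
  by (rule eqI2; simp add: q1.index_mult sum_lessThan_2)+

lemma smult2: "c \<cdot>\<^sub>m diag2 a b = diag2 (c * a) (c * b)" "c \<cdot>\<^sub>m anti2 a b = anti2 (c * a) (c * b)"
  by (rule eqI2; simp)+

lemma adjoint2:
  "mat_adjoint (diag2 a b) = diag2 (cnj a) (cnj b)"
  "mat_adjoint (anti2 a b) = anti2 (cnj b) (cnj a)"
  by (rule eqI2; simp add: q1.index_adjoint)+

lemma one2: "1\<^sub>m 2 = diag2 1 1"
  by (rule eqI2) auto

lemma pauli_closed [simp]: "pauli_X \<in> carrier_mat 2 2" "pauli_Z \<in> carrier_mat 2 2"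
  by (simp_all add: pauli_X_def pauli_Z_def mat_of_rows_list_def numeral_2_eq_2)

lemma pauli2: "pauli_X = anti2 1 1" "pauli_Z = diag2 1 (- 1)"
  by (rule eqI2; simp; simp add: pauli_X_def pauli_Z_def mat_of_rows_list_def)+

lemma cnj_mult_unit: "cmod a = 1 \<Longrightarrow> cnj a * a = 1"
  by (metis complex_norm_square mult.commute of_real_1 power_one)

lemma unitary2: "cmod a = 1 \<Longrightarrow> cmod b = 1 \<Longrightarrow> q1.unitary (diag2 a b)"
    "cmod a = 1 \<Longrightarrow> cmod b = 1 \<Longrightarrow> q1.unitary (anti2 a b)"
  by (rule q1.unitaryI; simp add: adjoint2 mult2 cnj_mult_unit one2)+

lemma hadamard_closed [simp]: "hadamard \<in> carrier_mat 2 2"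
  by (simp add: hadamard_def mat_of_rows_list_def numeral_2_eq_2)

text \<open>Abstracting the entry to \<open>s\<close> keeps the square root away from simp;
  \<open>s * s = 1 / 2\<close> and \<open>cnj s = s\<close> carry the calculations.\<close>

lemma hadamard_entries:
  obtains s where "s = complex_of_real (1 / sqrt 2)" "s * s = 1 / 2" "cnj s = s"
    "hadamard $$ (0, 0) = s" "hadamard $$ (0, Suc 0) = s"
    "hadamard $$ (Suc 0, 0) = s" "hadamard $$ (Suc 0, Suc 0) = - s"
proof
  show "complex_of_real (1 / sqrt 2) = complex_of_real (1 / sqrt 2)" ..
qed (simp_all only: q1.half_sqrt complex_cnj_complex_of_real, simp_all add: hadamard_def mat_of_rows_list_def)

lemma hadamard_eq: "hadamard = complex_of_real (1 / sqrt 2) \<cdot>\<^sub>m (pauli_X + pauli_Z)"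
  by (rule hadamard_entries, rule eqI2) (simp_all add: pauli2)

lemma hadamard_adjoint: "mat_adjoint hadamard = hadamard"
  by (rule hadamard_entries, rule eqI2) (simp_all add: q1.index_adjoint)

lemma hadamard_unitary: "q1.unitary hadamard"
  by (rule hadamard_entries, rule q1.unitaryI, simp, rule eqI2)
    (simp_all add: hadamard_adjoint q1.index_mult sum_lessThan_2)

lemma hadamard_conj: "hadamard * (pauli_Z * hadamard) = pauli_X"
  by (rule hadamard_entries, rule eqI2) (simp_all add: pauli2 q1.index_mult sum_lessThan_2)

text \<open>The one-qubit Pauli group with arbitrary unit phases: the diagonal elements are
  multiples of 1 and Z, the antidiagonal ones multiples of X and Y.\<close>

definition pauli1 :: "complex mat set" where
  "pauli1 = {A. \<exists>a \<epsilon>. cmod a = 1 \<and> \<epsilon> \<in> {1, - 1} \<and> (A = diag2 a (\<epsilon> * a) \<or> A = anti2 a (\<epsilon> * a))}"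

lemma pauli1_cases:
  assumes "A \<in> pauli1"
  obtains (diag) a \<epsilon> where "cmod a = 1" "\<epsilon> = 1 \<or> \<epsilon> = - 1" "A = diag2 a (\<epsilon> * a)"
    | (anti) a \<epsilon> where "cmod a = 1" "\<epsilon> = 1 \<or> \<epsilon> = - 1" "A = anti2 a (\<epsilon> * a)"
  using assms unfolding pauli1_def by blast

lemma pauli1_I:
  "cmod a = 1 \<Longrightarrow> b = a \<or> b = - a \<Longrightarrow> diag2 a b \<in> pauli1"
  "cmod a = 1 \<Longrightarrow> b = a \<or> b = - a \<Longrightarrow> anti2 a b \<in> pauli1"
  unfolding pauli1_def by (force intro: exI[of _ 1] exI[of _ "- 1"])+

lemma pauli1_closed: "A \<in> pauli1 \<Longrightarrow> A \<in> carrier_mat 2 2"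
  by (auto simp: pauli1_def)

lemma pauli1_unitary: "A \<in> pauli1 \<Longrightarrow> q1.unitary A"
  by (erule pauli1_cases) (auto intro!: unitary2 simp: norm_mult)

lemma pauli1_mult: "A \<in> pauli1 \<Longrightarrow> B \<in> pauli1 \<Longrightarrow> A * B \<in> pauli1"
  by (elim pauli1_cases; auto simp: mult2 norm_mult intro!: pauli1_I)

lemma pauli1_smult: "A \<in> pauli1 \<Longrightarrow> cmod c = 1 \<Longrightarrow> c \<cdot>\<^sub>m A \<in> pauli1"
  by (elim pauli1_cases; auto simp: smult2 norm_mult intro!: pauli1_I)

lemma pauli1_gen: "1\<^sub>m 2 \<in> pauli1" "pauli_X \<in> pauli1" "pauli_Z \<in> pauli1"
  by (simp_all add: one2 pauli2 pauli1_I)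

lemma pauli1_twist:
  assumes "A \<in> pauli1" "B \<in> pauli1"
  obtains \<epsilon> where "\<epsilon> = 1 \<or> \<epsilon> = - 1" "q1.twist \<epsilon> A B"
proof -
  have "q1.twist 1 A B \<or> q1.twist (- 1) A B"
    using assms by (elim pauli1_cases; auto simp: q1.twist_def mult2 smult2 mult.commute)
  with that show ?thesis by blast
qed

text \<open>Diagonal elements are already multiples of 1 or Z; a Hadamard gate followed by a phase
  gate carries Z to X or Y.\<close>

lemma pauli1_diagonalize:
  assumes "A \<in> pauli1"
  shows "\<exists>c h b. cmod c = 1 \<and> q1.unitary h \<and>
    A = c \<cdot>\<^sub>m (h * ((if b then pauli_Z else 1\<^sub>m 2) * mat_adjoint h))"
proof -
  have diag_form: "diag2 a (\<epsilon> * a) = a \<cdot>\<^sub>m (1\<^sub>m 2 * ((if \<epsilon> = - 1 then pauli_Z else 1\<^sub>m 2) * mat_adjoint (1\<^sub>m 2)))"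
    if "\<epsilon> = 1 \<or> \<epsilon> = - 1" for a \<epsilon>
    using that by (auto simp: pauli2 one2 adjoint2 mult2 smult2)
  have anti_form: "\<exists>h. q1.unitary h \<and> anti2 (c * z) (c * cnj z) = c \<cdot>\<^sub>m (h * (pauli_Z * mat_adjoint h))"
    if "cmod c = 1" "cmod z = 1" for c z
  proof (intro exI conjI)
    \<comment> \<open>The Hadamard gate turns Z into X, and the phase gate then turns X into
      \<open>anti2 z (cnj z)\<close>.\<close>
    let ?h = "diag2 1 (cnj z) * hadamard"
    show "q1.unitary ?h"
      using that by (intro q1.unitary_mult unitary2 hadamard_unitary) auto
    have "?h * (pauli_Z * mat_adjoint ?h) = diag2 1 (cnj z) * (hadamard * (pauli_Z * hadamard)) * diag2 1 z"
      by (simp add: q1.adjoint q1.assoc hadamard_adjoint adjoint2)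
    then show "anti2 (c * z) (c * cnj z) = c \<cdot>\<^sub>m (?h * (pauli_Z * mat_adjoint ?h))"
      unfolding hadamard_conj by (simp add: pauli2 mult2 smult2)
  qed
  from assms show ?thesis
  proof (cases rule: pauli1_cases)
    case (diag a \<epsilon>)
    with diag_form show ?thesis
      using q1.unitary_one by metis
  next
    case (anti a \<epsilon>)
    consider "\<epsilon> = 1" | "\<epsilon> = - 1" using anti by blast
    then obtain c z where "cmod c = 1" "cmod z = 1" "c * z = a" "c * cnj z = \<epsilon> * a"
    proof cases
      case 1 then show ?thesis using anti that[of a 1] by simp
    next
      \<comment> \<open>The choice z = -i produces Y, and c = i a restores the entries a and
        -a.\<close>
      case 2 then show ?thesis using anti that[of "\<i> * a" "- \<i>"] by (simp add: norm_mult mult_ac)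
    qed
    with anti anti_form[of c z] show ?thesis
      by (auto intro: exI[of _ True])
  qed
qed

context qubits
begin

definition pauli :: "complex mat set" where
  "pauli = {tensor n u | u. \<forall>i<n. u i \<in> pauli1}"

lemma pauliI: "(\<And>i. i < n \<Longrightarrow> u i \<in> pauli1) \<Longrightarrow> tensor n u \<in> pauli"
  by (auto simp: pauli_def)

lemma pauliE:
  assumes "P \<in> pauli"
  obtains u where "P = tensor n u" "\<And>i. i < n \<Longrightarrow> u i \<in> pauli1"
proof -
  from assms obtain u where "P = tensor n u" "\<forall>i<n. u i \<in> pauli1"
    unfolding pauli_def by blast
  with that[of u] show ?thesis by simp
qed

lemma pauli_unitary: "P \<in> pauli \<Longrightarrow> unitary P"
  by (elim pauliE) (simp add: tensor_unitary pauli1_unitary)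

lemma pauli_M [simp]: "P \<in> pauli \<Longrightarrow> P \<in> M"
  by (auto elim: pauliE)

lemma pauli_mult: "P \<in> pauli \<Longrightarrow> Q \<in> pauli \<Longrightarrow> P * Q \<in> pauli"
  by (elim pauliE) (simp add: tensor_mult pauli1_closed pauliI pauli1_mult)

text \<open>The scalar is absorbed into factor 0, which exists because \<open>0 < n\<close>.\<close>

lemma pauli_smult:
  assumes "0 < n" "P \<in> pauli" "cmod c = 1"
  shows "c \<cdot>\<^sub>m P \<in> pauli"
proof -
  obtain u where u: "P = tensor n u" "\<And>i. i < n \<Longrightarrow> u i \<in> pauli1"
    using pauliE[OF assms(2)] by metis
  let ?c = "\<lambda>i. if i = 0 then c else 1"
  have "c \<cdot>\<^sub>m P = tensor n (\<lambda>i. ?c i \<cdot>\<^sub>m u i)"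
    using assms(1) u by (subst tensor_smult) (auto simp: pauli1_closed prod.If_cases prod.delta)
  also have "\<dots> \<in> pauli"
    using u assms(3) by (intro pauliI pauli1_smult) auto
  finally show ?thesis .
qed

text \<open>The factors on each qubit commute up to a sign \<open>e i\<close>, and the tensor
  products commute up to the product of these signs.\<close>

lemma pauli_twist:
  assumes "P \<in> pauli" "Q \<in> pauli"
  shows "comm P Q \<or> anti P Q"
proof -
  obtain u v where P: "P = tensor n u" "\<And>i. i < n \<Longrightarrow> u i \<in> pauli1"
    and Q: "Q = tensor n v" "\<And>i. i < n \<Longrightarrow> v i \<in> pauli1"
    using assms by (auto elim!: pauliE)
  have "\<forall>i. \<exists>\<epsilon>. i < n \<longrightarrow> (\<epsilon> = 1 \<or> \<epsilon> = - 1) \<and> q1.twist \<epsilon> (u i) (v i)"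
    using P Q by (metis pauli1_twist)
  then obtain e where e: "\<And>i. i < n \<Longrightarrow> e i = 1 \<or> e i = - 1" "\<And>i. i < n \<Longrightarrow> q1.twist (e i) (u i) (v i)"
    by metis
  have "P * Q = tensor n (\<lambda>i. e i \<cdot>\<^sub>m (v i * u i))"
    using P Q e by (simp add: tensor_mult pauli1_closed q1.twist_def cong: tensor_cong)
  also have "\<dots> = (\<Prod>i<n. e i) \<cdot>\<^sub>m (Q * P)"
    using P Q by (subst tensor_smult) (auto simp: tensor_mult pauli1_closed)
  finally have "twist (\<Prod>i<n. e i) P Q"
    by (simp add: twist_def)
  moreover have "(\<Prod>i<m. e i) = 1 \<or> (\<Prod>i<m. e i) = - 1" if "m \<le> n" for m
    using that
  proof (induction m)
    case (Suc m)
    with e(1)[of m] show ?case by auto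
  qed simp
  ultimately show ?thesis by fastforce
qed

abbreviation X :: "nat \<Rightarrow> complex mat" where "X i \<equiv> on_qubit n i pauli_X"
abbreviation Z :: "nat \<Rightarrow> complex mat" where "Z i \<equiv> on_qubit n i pauli_Z"

lemma XZ_pauli: "i < n \<Longrightarrow> X i \<in> pauli" "i < n \<Longrightarrow> Z i \<in> pauli"
  by (auto simp: on_qubit_tensor single_def pauli1_gen intro!: pauliI)

lemma one_pauli: "1\<^sub>m (2 ^ n) \<in> pauli"
  unfolding tensor_one[symmetric] by (simp add: pauliI pauli1_gen)

lemma XZ_hermitian: "hermitian (X i)" "hermitian (Z i)"
  by (simp_all add: hermitian_def on_qubit_adjoint pauli2 adjoint2)

lemma on_qubit_comm:
  assumes "i < n" "j < n" "i \<noteq> j" "A \<in> carrier_mat 2 2" "B \<in> carrier_mat 2 2"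
  shows "comm (on_qubit n i A) (on_qubit n j B)"
proof -
  have "tensor n (\<lambda>k. single i A k * single j B k) = tensor n (\<lambda>k. single j B k * single i A k)"
    using assms by (intro tensor_cong) (auto simp: single_def)
  then show ?thesis
    using assms by (simp add: comm_iff on_qubit_tensor tensor_mult single_def)
qed

lemma XZ_anti: "i < n \<Longrightarrow> anti (X i) (Z i)" "i < n \<Longrightarrow> anti (Z i) (X i)"
  by (simp_all add: twist_def on_qubit_mult pauli2 mult2 smult2 flip: on_qubit_smult)

lemma XZ_square: "i < n \<Longrightarrow> X i * X i = 1\<^sub>m (2 ^ n)" "i < n \<Longrightarrow> Z i * Z i = 1\<^sub>m (2 ^ n)"
  by (simp_all add: on_qubit_mult pauli2 mult2 flip: one2 on_qubit_one)

lemma on_qubit_unitary: "i < n \<Longrightarrow> q1.unitary A \<Longrightarrow> unitary (on_qubit n i A)"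
  by (simp add: on_qubit_tensor tensor_unitary single_def q1.unitary_one)

section \<open>Matrices acting on a single qubit\<close>

lemma flip_bit_less: "i < n \<Longrightarrow> x < 2 ^ n \<Longrightarrow> flip_bit i x < 2 ^ n" for x :: nat
  by (metis take_bit_flip_bit_eq take_bit_nat_eq_self_iff not_less)

lemma flip_bit_flip_bit [simp]: "flip_bit i (flip_bit i x) = x" for x :: nat
  by (rule bit_eqI) (auto simp: bit_flip_bit_iff)

lemma X_index:
  assumes "i < n" "x < 2 ^ n" "y < 2 ^ n"
  shows "X i $$ (x, y) = (if x = flip_bit i y then 1 else 0)"
proof -
  have "x = flip_bit i y \<longleftrightarrow> (\<forall>j<n. j \<noteq> i \<longrightarrow> bit x j = bit y j) \<and> bit x i \<noteq> bit y i"
  proof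
    assume "(\<forall>j<n. j \<noteq> i \<longrightarrow> bit x j = bit y j) \<and> bit x i \<noteq> bit y i"
    then show "x = flip_bit i y"
      using assms by (intro bits_eqI[of _ n]) (auto simp: flip_bit_less bit_flip_bit_iff)
  qed (auto simp: bit_flip_bit_iff)
  then show ?thesis
    using assms by (auto simp: on_qubit_index pauli2)
qed

lemma Z_index:
  assumes "i < n" "x < 2 ^ n" "y < 2 ^ n"
  shows "Z i $$ (x, y) = (if x = y then if bit x i then - 1 else 1 else 0)"
proof -
  have "x = y" if "\<forall>j<n. j \<noteq> i \<longrightarrow> bit x j = bit y j" "bit x i = bit y i"
    using assms that by (intro bits_eqI[of _ n]) auto
  then show ?thesis
    using assms by (auto simp: on_qubit_index pauli2)
qed

lemma X_mult_index:
  assumes "A \<in> M" "i < n" "x < 2 ^ n" "y < 2 ^ n"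
  shows "(X i * A) $$ (x, y) = A $$ (flip_bit i x, y)" "(A * X i) $$ (x, y) = A $$ (x, flip_bit i y)"
proof -
  have *: "x = flip_bit i k \<longleftrightarrow> k = flip_bit i x" for k
    by (metis flip_bit_flip_bit)
  show "(X i * A) $$ (x, y) = A $$ (flip_bit i x, y)" "(A * X i) $$ (x, y) = A $$ (x, flip_bit i y)"
    using assms by (simp_all add: index_mult X_index * flip_bit_less sum_delta_mult)
qed

lemma Z_mult_index:
  assumes "A \<in> M" "i < n" "x < 2 ^ n" "y < 2 ^ n"
  shows "(Z i * A) $$ (x, y) = (if bit x i then - 1 else 1) * A $$ (x, y)"
    "(A * Z i) $$ (x, y) = (if bit y i then - 1 else 1) * A $$ (x, y)"
  using assms by (simp_all add: index_mult Z_index sum_delta_mult)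

text \<open>The qubit \<open>i\<close> may be out of range; in that case the conclusion says that \<open>K\<close> is a scalar.\<close>

lemma commutant:
  assumes K: "K \<in> M" and comm: "\<And>j. j < n \<Longrightarrow> j \<noteq> i \<Longrightarrow> comm K (X j)" "\<And>j. j < n \<Longrightarrow> j \<noteq> i \<Longrightarrow> comm K (Z j)"
  obtains A where "A \<in> carrier_mat 2 2" "K = on_qubit n i A"
proof
  \<comment> \<open>The entries of \<open>K\<close> at indices in which every bit other than
    \<open>i\<close> is clear.\<close>
  let ?A = "mat 2 2 (\<lambda>(a, b). K $$ (a * 2 ^ i, b * 2 ^ i))"
  show "?A \<in> carrier_mat 2 2"
    by simp
  \<comment> \<open>Comparing entries of K Z_j and Z_j K gives opposite signs where bit
    \<open>j\<close> differs.\<close>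
  have off: "K $$ (x, y) = 0" if "x < 2 ^ n" "y < 2 ^ n" "j < n" "j \<noteq> i" "bit x j \<noteq> bit y j" for x y j
  proof -
    have "(K * Z j) $$ (x, y) = (Z j * K) $$ (x, y)"
      using comm(2) that K by (simp add: comm_iff)
    then show ?thesis
      using that K by (auto simp: Z_mult_index split: if_splits)
  qed
  \<comment> \<open>Commuting with X_j allows bit \<open>j\<close> to be flipped in row and column
    at once; the induction clears the bits other than \<open>i\<close> one by one.\<close>
  have on: "K $$ (x, y) = K $$ (of_bool (bit x i) * 2 ^ i, of_bool (bit y i) * 2 ^ i)"
    if "x < 2 ^ n" "y < 2 ^ n" "\<forall>j<n. j \<noteq> i \<longrightarrow> bit x j = bit y j" for x y
    using that
  proof (induction x arbitrary: y rule: less_induct)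
    case (less x)
    show ?case
    proof (cases "\<exists>j. j \<noteq> i \<and> bit x j")
      case True
      then obtain j where j: "j \<noteq> i" "bit x j"
        by blast
      then have "j < n"
        using less.prems bit_less_exp by blast
      \<comment> \<open>Clearing a set bit subtracts a power of two, so the induction hypothesis
        applies.\<close>
      have "int (flip_bit j x) < int x"
        using j by (simp add: flip_bit_eq_if of_nat_unset_bit_eq unset_bit_eq bit_of_nat_iff_bit)
      then have "flip_bit j x < x"
        by simp
      have "(K * X j) $$ (x, flip_bit j y) = (X j * K) $$ (x, flip_bit j y)"
        using comm(1) j \<open>j < n\<close> K by (simp add: comm_iff)
      then have "K $$ (x, y) = K $$ (flip_bit j x, flip_bit j y)"
        using less.prems K \<open>j < n\<close> by (simp add: X_mult_index flip_bit_less)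
      also have "\<dots> = K $$ (of_bool (bit (flip_bit j x) i) * 2 ^ i, of_bool (bit (flip_bit j y) i) * 2 ^ i)"
        using less.prems \<open>j < n\<close> j
        by (intro less.IH \<open>flip_bit j x < x\<close> flip_bit_less) (auto simp: bit_flip_bit_iff)
      finally show ?thesis
        using j by (simp add: bit_flip_bit_iff)
    next
      case False
      have "z = of_bool (bit z i) * 2 ^ i" if "\<And>j. j \<noteq> i \<Longrightarrow> \<not> bit z j" for z :: nat
      proof (rule bit_eqI)
        fix k show "bit z k = bit (of_bool (bit z i) * 2 ^ i :: nat) k"
          using that by (cases "k = i") (auto simp: bit_exp_iff)
      qed
      moreover have "\<not> bit y j" if "j \<noteq> i" for j
        using False that less.prems bit_less_exp by blast
      ultimately show ?thesis
        using False by metis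
    qed
  qed
  show "K = on_qubit n i ?A"
  proof (rule eqI)
    fix x y :: nat assume xy: "x < 2 ^ n" "y < 2 ^ n"
    show "K $$ (x, y) = on_qubit n i ?A $$ (x, y)"
    proof (cases "\<forall>j<n. j \<noteq> i \<longrightarrow> bit x j = bit y j")
      case True
      have "on_qubit n i ?A $$ (x, y) = ?A $$ (of_bool (bit x i), of_bool (bit y i))"
        unfolding on_qubit_index[OF xy] by (rule if_P[OF True])
      also have "\<dots> = K $$ (of_bool (bit x i) * 2 ^ i, of_bool (bit y i) * 2 ^ i)"
        by (simp only: index_mat of_bool_less_2 split)
      finally show ?thesis
        using on[OF xy True] by simp
    next
      case False
      then have "on_qubit n i ?A $$ (x, y) = 0"
        unfolding on_qubit_index[OF xy] by (rule if_not_P)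
      then show ?thesis
        using False off[OF xy] by metis
    qed
  qed (use K in auto)
qed

lemma on_qubit_inj:
  assumes "i < n" "A \<in> carrier_mat 2 2" "B \<in> carrier_mat 2 2" "on_qubit n i A = on_qubit n i B"
  shows "A = B"
proof (rule q1.eqI)
  fix a b :: nat assume "a < 2" "b < 2"
  have "A $$ (of_bool p, of_bool q) = B $$ (of_bool p, of_bool q)" for p q
  proof -
    \<comment> \<open>These indices, with all bits other than \<open>i\<close> clear, expose the
      entries of \<open>A\<close> and \<open>B\<close>.\<close>
    have "of_bool r * 2 ^ i < (2 ^ n :: nat)" "bit (of_bool r * 2 ^ i :: nat) j \<longleftrightarrow> r \<and> j = i" for r j
      using assms(1) by (cases r; auto simp: bit_exp_iff)+
    then show ?thesis
      using arg_cong[OF assms(4), of "\<lambda>A. A $$ (of_bool p * 2 ^ i, of_bool q * 2 ^ i)"]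
      by (simp add: on_qubit_index)
  qed
  from this[of "a = 1" "b = 1"] \<open>a < 2\<close> \<open>b < 2\<close> show "A $$ (a, b) = B $$ (a, b)"
    by (auto simp: less_2_cases_iff)
qed (use assms in auto)

lemma unitary_on_qubit_iff:
  assumes "i < n" "A \<in> carrier_mat 2 2" "unitary (on_qubit n i A)"
  shows "q1.unitary A"
proof (rule q1.unitaryI)
  have "on_qubit n i (mat_adjoint A * A) = on_qubit n i (1\<^sub>m 2)"
    using unitary_cancel(1)[OF assms(3)] assms by (simp add: on_qubit_adjoint on_qubit_mult on_qubit_one)
  then show "mat_adjoint A * A = 1\<^sub>m 2"
    by (rule on_qubit_inj[OF assms(1), rotated 2]) (use assms(2) in simp_all)
qed (use assms in simp)

end

section \<open>Exponentials of diagonalized matrices\<close>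

context square
begin

definition diagm :: "(nat \<Rightarrow> complex) \<Rightarrow> complex mat" where
  "diagm f = mat d d (\<lambda>(x, y). if x = y then f x else 0)"

lemma diagm_closed [simp]: "diagm f \<in> M"
  by (simp add: diagm_def)

lemma diagm_index: "x < d \<Longrightarrow> y < d \<Longrightarrow> diagm f $$ (x, y) = (if x = y then f x else 0)"
  by (simp add: diagm_def)

lemma diagm_mult: "diagm f * diagm g = diagm (\<lambda>x. f x * g x)"
  by (rule eqI) (auto simp: index_mult diagm_index sum_delta_mult)

lemma diagm_smult: "c \<cdot>\<^sub>m diagm f = diagm (\<lambda>x. c * f x)"
  by (rule eqI) (auto simp: diagm_index)

lemma diagm_add: "diagm f + diagm g = diagm (\<lambda>x. f x + g x)"
  by (rule eqI) (auto simp: diagm_index)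

lemma diagm_one: "1\<^sub>m d = diagm (\<lambda>_. 1)"
  by (rule eqI) (auto simp: diagm_index)

lemma diagm_cong: "(\<And>x. x < d \<Longrightarrow> f x = g x) \<Longrightarrow> diagm f = diagm g"
  by (rule eqI) (auto simp: diagm_index)

lemma conj_diagm_index:
  assumes "V \<in> M" "W \<in> M" "x < d" "y < d"
  shows "(V * (diagm f * W)) $$ (x, y) = (\<Sum>k<d. V $$ (x, k) * f k * W $$ (k, y))"
proof -
  have "(diagm f * W) $$ (k, y) = f k * W $$ (k, y)" if "k < d" for k
    using assms that by (simp add: index_mult diagm_index sum_delta_mult)
  with assms show ?thesis
    by (simp add: index_mult mult.assoc)
qed

lemma pow_conj_diagm:
  assumes "V \<in> M" "W \<in> M" "V * W = 1\<^sub>m d" "W * V = 1\<^sub>m d"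
  shows "(V * (diagm f * W)) ^\<^sub>m k = V * (diagm (\<lambda>x. f x ^ k) * W)"
proof (induction k)
  case 0
  show ?case
    using assms by (simp add: expand flip: diagm_one)
next
  case (Suc k)
  have "V * (diagm (\<lambda>x. f x ^ k) * W) * (V * (diagm f * W)) =
      V * (diagm (\<lambda>x. f x ^ k) * (W * V) * (diagm f * W))"
    using assms(1,2) by (simp add: assoc)
  also have "\<dots> = V * (diagm (\<lambda>x. f x ^ k) * diagm f * W)"
    using assms by (simp add: expand)
  finally show ?case
    by (simp add: Suc.IH diagm_mult mult.commute)
qed

text \<open>By \<open>pow_conj_diagm\<close> each entry of the matrix series is a finite linear
  combination of scalar exponential series, so the sum may be taken termwise.\<close>

lemma mat_exp_conj_diagm:
  assumes "V \<in> M" "W \<in> M" "V * W = 1\<^sub>m d" "W * V = 1\<^sub>m d"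
  shows "mat_exp (V * (diagm f * W)) = V * (diagm (\<lambda>x. exp (f x)) * W)"
proof (rule eqI)
  let ?A = "V * (diagm f * W)"
  have A: "?A \<in> M"
    using assms by simp
  then show "mat_exp ?A \<in> M"
    by (auto simp: mat_exp_def)
  fix x y assume xy: "x < d" "y < d"
  have "(\<lambda>n. \<Sum>k<d. V $$ (x, k) * (f k ^ n /\<^sub>R fact n) * W $$ (k, y)) sums
      (\<Sum>k<d. V $$ (x, k) * exp (f k) * W $$ (k, y))"
    by (intro sums_sum sums_mult sums_mult2 exp_converges)
  also have "(\<lambda>n. \<Sum>k<d. V $$ (x, k) * (f k ^ n /\<^sub>R fact n) * W $$ (k, y)) =
      (\<lambda>n. (?A ^\<^sub>m n) $$ (x, y) / fact n)"
    using assms xy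
    by (simp add: pow_conj_diagm conj_diagm_index sum_divide_distrib scaleR_conv_of_real field_simps)
  finally have "(\<Sum>n. (?A ^\<^sub>m n) $$ (x, y) / fact n) = (V * (diagm (\<lambda>x. exp (f x)) * W)) $$ (x, y)"
    using assms xy by (simp add: conj_diagm_index sums_iff)
  then show "mat_exp ?A $$ (x, y) = (V * (diagm (\<lambda>x. exp (f x)) * W)) $$ (x, y)"
    using carrier_matD(1)[OF assms(1)] xy by (simp add: mat_exp_def)
qed (use assms in auto)

lemma mat_exp_diagm: "mat_exp (diagm f) = diagm (\<lambda>x. exp (f x))"
  using mat_exp_conj_diagm[of "1\<^sub>m d" "1\<^sub>m d" f] by (simp add: expand)

end

section \<open>Implementable matrices\<close>

lemma circuit_mat_snoc: "circuit_mat n m (gs @ [g]) = m n g * circuit_mat n m gs"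
  by (simp add: circuit_mat_def)

context qubits
begin

lemma output_gate_M: "output_gate_mat n g \<in> M"
  by (cases g) (auto simp: gms_def mat_exp_def mat_sum_def)

lemma circuit_M: "(\<And>g. m n g \<in> M) \<Longrightarrow> circuit_mat n m gs \<in> M"
  by (induction gs rule: rev_induct) (simp add: circuit_mat_def, simp add: circuit_mat_snoc)

lemma circuit_append:
  assumes "\<And>g. m n g \<in> M"
  shows "circuit_mat n m (gs @ hs) = circuit_mat n m hs * circuit_mat n m gs"
proof (induction hs rule: rev_induct)
  case Nil
  show ?case
    using circuit_M[of m gs] assms by (simp add: circuit_mat_def[of _ _ "[]"] expand)
next
  case (snoc h hs)
  then show ?case
    using circuit_M[of m] assms by (simp add: circuit_mat_snoc assoc flip: append_assoc)
qed

text \<open>The index counts GMS gates only, so \<open>impl 0\<close> collects the free, local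
  operations. The scalar \<open>c\<close> absorbs the global phase, which makes later statements
  plain equations.\<close>

definition impl :: "nat \<Rightarrow> complex mat set" where
  "impl k = {A. \<exists>D c. output_circuit n D \<and> length (filter is_gms D) \<le> k \<and> cmod c = 1 \<and>
     A = c \<cdot>\<^sub>m circuit_mat n output_gate_mat D}"

lemma impl_closed: "A \<in> impl k \<Longrightarrow> A \<in> M"
  using circuit_M[of output_gate_mat] output_gate_M by (auto simp: impl_def)

lemma impl_mono: "A \<in> impl j \<Longrightarrow> j \<le> k \<Longrightarrow> A \<in> impl k"
  unfolding impl_def using order_trans by blast

lemma impl_mult:
  assumes "A \<in> impl j" "B \<in> impl k"
  shows "A * B \<in> impl (j + k)"
proof -
  obtain D c where D: "output_circuit n D" "length (filter is_gms D) \<le> j" "cmod c = 1"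
    "A = c \<cdot>\<^sub>m circuit_mat n output_gate_mat D"
    using assms(1) by (auto simp: impl_def)
  obtain E e where E: "output_circuit n E" "length (filter is_gms E) \<le> k" "cmod e = 1"
    "B = e \<cdot>\<^sub>m circuit_mat n output_gate_mat E"
    using assms(2) by (auto simp: impl_def)
  \<comment> \<open>Circuits list gates in order of application, so the right factor's circuit comes
    first.\<close>
  have "A * B = (c * e) \<cdot>\<^sub>m circuit_mat n output_gate_mat (E @ D)"
    using D(4) E(4) circuit_M[of output_gate_mat] output_gate_M
    by (simp add: circuit_append expand mult.commute)
  then show ?thesis
    unfolding impl_def using D E
    by (auto intro!: exI[of _ "E @ D"] exI[of _ "c * e"] simp: output_circuit_def norm_mult)
qed

lemma impl_mult_local: "A \<in> impl 0 \<Longrightarrow> B \<in> impl k \<Longrightarrow> A * B \<in> impl k"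
  "A \<in> impl k \<Longrightarrow> B \<in> impl 0 \<Longrightarrow> A * B \<in> impl k"
  using impl_mult[of A 0 B k] impl_mult[of A k B 0] by simp_all

lemma impl_smult:
  assumes "A \<in> impl k" "cmod c = 1"
  shows "c \<cdot>\<^sub>m A \<in> impl k"
proof -
  obtain D e where D: "output_circuit n D" "length (filter is_gms D) \<le> k" "cmod e = 1"
    "A = e \<cdot>\<^sub>m circuit_mat n output_gate_mat D"
    using assms(1) by (auto simp: impl_def)
  have "c \<cdot>\<^sub>m A = (c * e) \<cdot>\<^sub>m circuit_mat n output_gate_mat D"
    using D(4) circuit_M[of output_gate_mat] output_gate_M by (simp add: expand)
  then show ?thesis
    unfolding impl_def using D assms(2)
    by (auto intro!: exI[of _ D] exI[of _ "c * e"] simp: norm_mult)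
qed

lemma impl_one: "1\<^sub>m (2 ^ n) \<in> impl k"
  unfolding impl_def
  by (auto intro!: exI[of _ "[]"] exI[of _ 1] simp: output_circuit_def circuit_mat_def expand)

lemma impl_gate:
  assumes "valid_output_gate n g" "is_gms g \<Longrightarrow> 0 < k"
  shows "output_gate_mat n g \<in> impl k"
  unfolding impl_def using assms output_gate_M[of g]
  by (auto intro!: exI[of _ "[g]"] exI[of _ 1] simp: output_circuit_def circuit_mat_def expand)

lemma gms_impl: "S \<subseteq> {..<n} \<Longrightarrow> gms n S \<alpha> \<in> impl 1"
  using impl_gate[of "GMS S \<alpha>" 1] by simp

lemma on_qubit_impl:
  assumes "i < n" "q1.unitary A"
  shows "on_qubit n i A \<in> impl 0"
proof -
  have "valid_output_gate n (Single_Qubit i A)"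
    using assms q1.unitary_closed[OF assms(2)] q1.unitary_cancel(1)[OF assms(2)]
      carrier_matD[OF q1.unitary_closed[OF assms(2)]]
    by (simp add: is_unitary_def)
  then show ?thesis
    using impl_gate[of "Single_Qubit i A" 0] by simp
qed

text \<open>A tensor product is a product of single-qubit gates; the induction on \<open>m\<close>
  puts the factors in place one at a time.\<close>

lemma tensor_impl:
  assumes u: "\<And>i. i < n \<Longrightarrow> q1.unitary (u i)"
  shows "tensor n u \<in> impl 0"
proof -
  have "tensor n (\<lambda>i. if i < m then u i else 1\<^sub>m 2) \<in> impl 0" if "m \<le> n" for m
    using that
  proof (induction m)
    case 0
    show ?case by (simp add: tensor_one impl_one)
  next
    case (Suc m)
    have "on_qubit n m (u m) * tensor n (\<lambda>i. if i < m then u i else 1\<^sub>m 2) =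
        tensor n (\<lambda>i. single m (u m) i * (if i < m then u i else 1\<^sub>m 2))"
      using Suc.prems u by (subst on_qubit_tensor, simp, subst tensor_mult) (auto simp: single_def)
    also have "\<dots> = tensor n (\<lambda>i. if i < Suc m then u i else 1\<^sub>m 2)"
    proof (rule tensor_cong)
      fix i assume "i < n"
      then have "u i \<in> carrier_mat 2 2" "u m \<in> carrier_mat 2 2"
        using Suc.prems u by auto
      then show "single m (u m) i * (if i < m then u i else 1\<^sub>m 2) = (if i < Suc m then u i else 1\<^sub>m 2)"
        by (auto simp: single_def less_Suc_eq q1.expand)
    qed
    finally have eq: "on_qubit n m (u m) * tensor n (\<lambda>i. if i < m then u i else 1\<^sub>m 2) =
        tensor n (\<lambda>i. if i < Suc m then u i else 1\<^sub>m 2)" .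
    have "on_qubit n m (u m) \<in> impl 0"
      using Suc.prems by (intro on_qubit_impl u) auto
    from impl_mult_local(1)[OF this Suc.IH] Suc.prems show ?case
      unfolding eq by simp
  qed
  moreover have "tensor n (\<lambda>i. if i < n then u i else 1\<^sub>m 2) = tensor n u"
    by (rule tensor_cong) simp
  ultimately show ?thesis
    by (metis order_refl)
qed

lemma pauli_impl: "P \<in> pauli \<Longrightarrow> P \<in> impl 0"
  by (elim pauliE) (simp add: tensor_impl pauli1_unitary)

section \<open>The gates as matrices\<close>

lemma tensor_diag:
  "tensor n (\<lambda>i. diag2 1 (z i)) = diagm (\<lambda>x. \<Prod>i<n. if bit x i then z i else 1)"
proof (rule eqI)
  fix x y :: nat assume xy: "x < 2 ^ n" "y < 2 ^ n"
  show "tensor n (\<lambda>i. diag2 1 (z i)) $$ (x, y) = diagm (\<lambda>x. \<Prod>i<n. if bit x i then z i else 1) $$ (x, y)"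
  proof (cases "x = y")
    case True
    with xy show ?thesis
      by (auto simp: tensor_index diagm_index intro!: prod.cong)
  next
    case False
    then obtain i where "i < n" "bit x i \<noteq> bit y i"
      using xy bits_eqI by blast
    then have "tensor n (\<lambda>i. diag2 1 (z i)) $$ (x, y) = 0"
      unfolding tensor_index[OF xy] by (intro prod_zero) auto
    with False xy show ?thesis
      by (simp add: diagm_index)
  qed
qed auto

text \<open>The Hamming weight of \<open>x\<close> within \<open>S\<close>, on which alone the
  eigenvalues of a GMS gate on \<open>S\<close> depend.\<close>

definition support :: "nat set \<Rightarrow> nat \<Rightarrow> nat" where
  "support S x = card {i \<in> S. bit x i}"

lemma tensor_diag_on:
  assumes "S \<subseteq> {..<n}"
  shows "tensor n (\<lambda>i. if i \<in> S then diag2 1 q else 1\<^sub>m 2) = diagm (\<lambda>x. q ^ support S x)"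
proof -
  have "tensor n (\<lambda>i. if i \<in> S then diag2 1 q else 1\<^sub>m 2) = tensor n (\<lambda>i. diag2 1 (if i \<in> S then q else 1))"
    by (rule tensor_cong) (simp add: one2)
  also have "\<dots> = diagm (\<lambda>x. q ^ support S x)"
    unfolding tensor_diag
  proof (rule diagm_cong)
    fix x :: nat
    have "(\<Prod>i<n. if bit x i then if i \<in> S then q else 1 else 1) = (\<Prod>i<n. if i \<in> S \<and> bit x i then q else 1)"
      by (rule prod.cong) auto
    also have "\<dots> = (\<Prod>i\<in>{i \<in> S. bit x i}. q)"
      using assms by (subst prod.If_cases) (auto simp: Int_absorb1 subset_iff intro!: prod.cong arg_cong[of _ _ card] arg_cong[of _ _ "(^) q"])
    finally show "(\<Prod>i<n. if bit x i then if i \<in> S then q else 1 else 1) = q ^ support S x"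
      by (simp add: support_def)
  qed
  finally show ?thesis .
qed

lemma Z_diagm: "i < n \<Longrightarrow> Z i = diagm (\<lambda>x. if bit x i then - 1 else 1)"
  by (rule eqI) (auto simp: Z_index diagm_index)

text \<open>Euler's formula on the eigenvalues 1 and -1. The result is affine in \<open>Z i\<close>,
  so whatever conjugates \<open>Z i\<close> carries the whole gate along.\<close>

lemma z_phase_eq:
  assumes "i < n"
  shows "z_phase n i \<alpha> =
    complex_of_real (cos (\<alpha> / 2)) \<cdot>\<^sub>m 1\<^sub>m (2 ^ n) + (- \<i> * complex_of_real (sin (\<alpha> / 2))) \<cdot>\<^sub>m Z i"
proof -
  have "exp (- (\<i> * complex_of_real a)) = complex_of_real (cos a) - \<i> * complex_of_real (sin a)"
    "exp (\<i> * complex_of_real a) = complex_of_real (cos a) + \<i> * complex_of_real (sin a)" for a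
    using cis_conv_exp[of "- a"] cis_conv_exp[of a] by (simp_all add: complex_eq_iff cis.ctr)
  from this[of "\<alpha> / 2"] show ?thesis
    using assms unfolding z_phase_def Z_diagm[OF assms]
    by (auto simp: diagm_one diagm_smult diagm_add mat_exp_diagm intro!: diagm_cong)
qed

section \<open>Spectrum of the GMS gates and the cost of a quarter-turn rotation\<close>

definition layer :: "complex mat" where
  "layer = tensor n (\<lambda>_. hadamard)"

lemma layer_M [simp]: "layer \<in> M"
  by (simp add: layer_def)

lemma layer_square: "layer * layer = 1\<^sub>m (2 ^ n)"
  using q1.unitary_cancel(1)[OF hadamard_unitary]
  by (simp add: layer_def tensor_mult hadamard_adjoint tensor_one)

lemma layer_cancel: "A \<in> M \<Longrightarrow> layer * (layer * A) = A"
  by (simp add: layer_square expand flip: assoc)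

lemma layer_conj:
  assumes "i < n"
  shows "X i = layer * (Z i * layer)"
proof -
  have "layer * (Z i * layer) = tensor n (\<lambda>j. hadamard * (single i pauli_Z j * hadamard))"
    using assms by (simp add: layer_def on_qubit_tensor tensor_mult single_def)
  also have "\<dots> = tensor n (single i pauli_X)"
    using q1.unitary_cancel(1)[OF hadamard_unitary]
    by (intro tensor_cong) (simp add: single_def hadamard_conj q1.expand hadamard_adjoint)
  finally show ?thesis
    using assms by (simp add: on_qubit_tensor)
qed

text \<open>The ordered pairs of distinct elements are the full square \<open>S \<times> S\<close>
  without its diagonal.\<close>

lemma sum_pairs:
  fixes e :: "nat \<Rightarrow> complex"
  assumes "finite S"
  shows "(\<Sum>(i, j)\<in>{(i, j). i \<in> S \<and> j \<in> S \<and> i \<noteq> j}. e i * e j) = (\<Sum>i\<in>S. e i)\<^sup>2 - (\<Sum>i\<in>S. e i * e i)"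
proof -
  let ?I = "{(i, j). i \<in> S \<and> j \<in> S \<and> i \<noteq> j}"
  have fin: "finite ?I"
    using assms by (intro finite_subset[of ?I "S \<times> S"]) auto
  have "(\<Sum>i\<in>S. e i)\<^sup>2 = (\<Sum>(i, j)\<in>S \<times> S. e i * e j)"
    by (simp add: power2_eq_square sum_product sum.cartesian_product)
  also have "S \<times> S = ?I \<union> (\<lambda>i. (i, i)) ` S"
    by auto
  also have "(\<Sum>(i, j)\<in>?I \<union> (\<lambda>i. (i, i)) ` S. e i * e j) =
      (\<Sum>(i, j)\<in>?I. e i * e j) + (\<Sum>i\<in>S. e i * e i)"
    using assms fin by (subst sum.union_disjoint) (auto simp: sum.reindex inj_on_def)
  finally show ?thesis by simp
qed

text \<open>Hadamard gates on all qubits turn every X into Z. On a basis state of weight s in S the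
  signs of the Z_i sum to |S| - 2 s, and \<open>sum_pairs\<close> turns the double sum into its
  square minus |S|.\<close>

lemma gms_diagonalize:
  assumes S: "S \<subseteq> {..<n}"
  shows "gms n S \<alpha> = layer * (diagm (\<lambda>x. exp (- \<i> * complex_of_real (\<alpha> / 4) *
    ((of_nat (card S) - 2 * of_nat (support S x))\<^sup>2 - of_nat (card S)))) * layer)"
proof -
  let ?I = "{(i, j). i \<in> S \<and> j \<in> S \<and> i \<noteq> j}"
  let ?e = "\<lambda>x i. if bit x i then - 1 else 1 :: complex"
  have fin: "finite S"
    using S finite_subset by blast
  have XX: "X i * X j = layer * (diagm (\<lambda>x. ?e x i * ?e x j) * layer)" if "i < n" "j < n" for i j
  proof -
    have "X i * X j = layer * (Z i * (layer * (layer * (Z j * layer))))"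
      using that by (simp add: layer_conj assoc)
    also have "\<dots> = layer * (Z i * Z j * layer)"
      by (simp add: layer_cancel assoc)
    finally show ?thesis
      using that by (simp add: Z_diagm diagm_mult)
  qed
  have "mat_sum (2 ^ n) (\<lambda>(i, j). X i * X j) ?I = layer * (diagm (\<lambda>x. \<Sum>(i, j)\<in>?I. ?e x i * ?e x j) * layer)"
  proof (rule eqI)
    fix x y :: nat assume xy: "x < 2 ^ n" "y < 2 ^ n"
    have "mat_sum (2 ^ n) (\<lambda>(i, j). X i * X j) ?I $$ (x, y) =
        (\<Sum>(i, j)\<in>?I. (X i * X j) $$ (x, y))"
      using xy by (simp add: mat_sum_def case_prod_unfold)
    also have "\<dots> = (\<Sum>(i, j)\<in>?I. \<Sum>k<2 ^ n. layer $$ (x, k) * (?e k i * ?e k j) * layer $$ (k, y))"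
    proof (rule sum.cong[OF refl])
      fix p assume "p \<in> ?I"
      then obtain i j where p: "p = (i, j)" "i < n" "j < n"
        using S by blast
      then show "(case p of (i, j) \<Rightarrow> (X i * X j) $$ (x, y)) =
          (case p of (i, j) \<Rightarrow> \<Sum>k<2 ^ n. layer $$ (x, k) * (?e k i * ?e k j) * layer $$ (k, y))"
        using xy by (simp only: XX split conj_diagm_index layer_M)
    qed
    also have "\<dots> = (\<Sum>k<2 ^ n. layer $$ (x, k) * (\<Sum>(i, j)\<in>?I. ?e k i * ?e k j) * layer $$ (k, y))"
      unfolding sum_distrib_left sum_distrib_right case_prod_unfold by (rule sum.swap)
    finally show "mat_sum (2 ^ n) (\<lambda>(i, j). X i * X j) ?I $$ (x, y) =
        (layer * (diagm (\<lambda>x. \<Sum>(i, j)\<in>?I. ?e x i * ?e x j) * layer)) $$ (x, y)"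
      using xy by (simp only: conj_diagm_index layer_M)
  qed (simp_all add: mat_sum_def)
  moreover have "(\<Sum>(i, j)\<in>?I. ?e x i * ?e x j) =
      (of_nat (card S) - 2 * of_nat (support S x))\<^sup>2 - of_nat (card S)" for x
  proof -
    have "?e x i = 1 - 2 * of_bool (bit x i)" "?e x i * ?e x i = 1" for i
      by auto
    then have "(\<Sum>i\<in>S. ?e x i) = of_nat (card S) - 2 * of_nat (support S x)" "(\<Sum>i\<in>S. ?e x i * ?e x i) = of_nat (card S)"
      using fin by (simp_all only: sum_subtractf sum_of_bool_eq support_def flip: sum_distrib_left)
        (simp_all add: Int_def)
    then show ?thesis
      using sum_pairs[OF fin, of "?e x"] by simp
  qed
  ultimately have "gms n S \<alpha> = mat_exp (layer * (diagm (\<lambda>x. - \<i> * complex_of_real (\<alpha> / 4) *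
      ((of_nat (card S) - 2 * of_nat (support S x))\<^sup>2 - of_nat (card S))) * layer))"
    unfolding gms_def diagm_smult[symmetric] by (simp only: expand layer_M diagm_closed closed)
  then show ?thesis
    by (simp only: mat_exp_conj_diagm layer_M layer_square)
qed

text \<open>At angle \<open>\<pi>/2\<close> the eigenvalue of a clique gate depends on the weight \<open>s\<close> only through a
  factor \<open>i ^ (w * s)\<close>, which is local, and the parity of \<open>s\<close>.\<close>

lemma clique_phase:
  "exp (- \<i> * complex_of_real (pi / 2 / 4) * ((of_nat w - 2 * of_nat s)\<^sup>2 - of_nat w)) =
    cis (- (pi / 8) * ((real w)\<^sup>2 - real w) - pi / 4) *
      ((\<i> ^ w) ^ s * (complex_of_real (1 / sqrt 2) * (1 + \<i> * (- 1) ^ s)))"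
proof -
  have sqrt_half: "sqrt 2 / 2 = 1 / sqrt 2"
    by (simp add: field_simps)
  \<comment> \<open>Modulo 4 the square of s is 0 or 1, which leaves the angle pi/4 for even s and
    -pi/4 for odd s.\<close>
  have parity: "cis (pi / 4 - (real s)\<^sup>2 * (pi / 2)) = complex_of_real (1 / sqrt 2) * (1 + \<i> * (- 1) ^ s)"
  proof (cases "even s")
    case True
    then obtain k where k: "s = 2 * k" by blast
    have "cis (pi / 4 - (real s)\<^sup>2 * (pi / 2)) = cis (pi / 4) * cis (2 * pi * (- (real k)\<^sup>2))"
      unfolding cis_mult k by (simp add: power2_eq_square algebra_simps)
    also have "cis (2 * pi * (- (real k)\<^sup>2)) = 1"
      by (intro cis_multiple_2pi) auto
    also have "cis (pi / 4) * 1 = complex_of_real (1 / sqrt 2) * (1 + \<i> * (- 1) ^ s)"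
      by (simp add: k complex_eq_iff cos_45 sin_45 sqrt_half)
    finally show ?thesis .
  next
    case False
    then obtain k where k: "s = 2 * k + 1" by (elim oddE)
    have "cis (pi / 4 - (real s)\<^sup>2 * (pi / 2)) = cis (- (pi / 4)) * cis (2 * pi * (- (real k)\<^sup>2 - real k))"
      unfolding cis_mult k by (simp add: power2_eq_square algebra_simps)
    also have "cis (2 * pi * (- (real k)\<^sup>2 - real k)) = 1"
      by (intro cis_multiple_2pi) auto
    also have "cis (- (pi / 4)) * 1 = complex_of_real (1 / sqrt 2) * (1 + \<i> * (- 1) ^ s)"
      by (simp add: k complex_eq_iff cos_45 sin_45 sqrt_half)
    finally show ?thesis .
  qed
  have "exp (- \<i> * complex_of_real (pi / 2 / 4) * ((of_nat w - 2 * of_nat s)\<^sup>2 - of_nat w)) =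
      cis (- (pi / 8) * ((real w - 2 * real s)\<^sup>2 - real w))"
    unfolding cis_conv_exp by (simp add: mult.assoc)
  \<comment> \<open>Expanding the square separates a constant, the cross term w s pi/2 and the term
    in s squared; pi/4 is added and subtracted to match \<open>parity\<close>.\<close>
  also have "- (pi / 8) * ((real w - 2 * real s)\<^sup>2 - real w) =
      (- (pi / 8) * ((real w)\<^sup>2 - real w) - pi / 4) + (real (w * s) * (pi / 2) + (pi / 4 - (real s)\<^sup>2 * (pi / 2)))"
    by (simp add: power2_eq_square algebra_simps)
  also have "cis \<dots> = cis (- (pi / 8) * ((real w)\<^sup>2 - real w) - pi / 4) *
      (cis (pi / 2) ^ (w * s) * cis (pi / 4 - (real s)\<^sup>2 * (pi / 2)))"
    by (simp only: Complex.DeMoivre Complex.cis_mult)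
  finally show ?thesis
    by (simp only: parity power_mult cis_pi_half)
qed

definition zs :: "nat set \<Rightarrow> complex mat" where
  "zs S = tensor n (\<lambda>i. if i \<in> S then pauli_Z else 1\<^sub>m 2)"

lemma zs_M [simp]: "zs S \<in> M"
  by (simp add: zs_def)

lemma zs_diagm: "S \<subseteq> {..<n} \<Longrightarrow> zs S = diagm (\<lambda>x. (- 1) ^ support S x)"
  unfolding zs_def pauli2 by (rule tensor_diag_on)

lemma zs_pauli: "zs S \<in> pauli"
  unfolding zs_def by (rule pauliI) (simp add: pauli1_gen)

lemma rot_zs_impl:
  assumes S: "S \<subseteq> {..<n}"
  shows "rot (\<i> \<cdot>\<^sub>m zs S) \<in> impl 1"
proof -
  define w where "w = card S"
  define c where "c = cis (- (pi / 8) * ((real w)\<^sup>2 - real w) - pi / 4)"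
  \<comment> \<open>The factor (i^w)^s is a phase gate diag(1, i^w) on each qubit of
    \<open>S\<close>, hence local.\<close>
  define T where "T = tensor n (\<lambda>i. if i \<in> S then diag2 1 (\<i> ^ w) else 1\<^sub>m 2)"
  have unit: "q1.unitary (if i \<in> S then diag2 1 (\<i> ^ w) else 1\<^sub>m 2)" for i
    by (simp add: unitary2 norm_power q1.unitary_one)
  have T: "unitary T" "mat_adjoint T \<in> impl 0"
    using unit unfolding T_def
    by (simp_all add: tensor_unitary tensor_adjoint tensor_impl q1.unitary_adjoint)
  have c: "cmod c = 1" "cnj c * c = 1"
    by (simp_all add: c_def cis_cnj cis_mult)
  have layer: "layer \<in> impl 0"
    by (simp add: layer_def tensor_impl hadamard_unitary)
  have "gms n S (pi / 2) = layer * (diagm (\<lambda>x. c * ((\<i> ^ w) ^ support S x *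
      (complex_of_real (1 / sqrt 2) * (1 + \<i> * (- 1) ^ support S x)))) * layer)"
    unfolding gms_diagonalize[OF S] w_def[symmetric] clique_phase c_def[symmetric] ..
  also have "diagm (\<lambda>x. c * ((\<i> ^ w) ^ support S x *
      (complex_of_real (1 / sqrt 2) * (1 + \<i> * (- 1) ^ support S x)))) = c \<cdot>\<^sub>m (T * rot (\<i> \<cdot>\<^sub>m zs S))"
    using S unfolding T_def rot_def
    by (simp only: tensor_diag_on zs_diagm diagm_one diagm_mult diagm_add diagm_smult)
  finally have gms: "gms n S (pi / 2) = layer * (c \<cdot>\<^sub>m (T * rot (\<i> \<cdot>\<^sub>m zs S)) * layer)" .
  \<comment> \<open>The factorization of the GMS gate is solved for the rotation; everything moved
    to the other side is local.\<close>
  have "rot (\<i> \<cdot>\<^sub>m zs S) = cnj c \<cdot>\<^sub>m (mat_adjoint T * (layer * gms n S (pi / 2) * layer))"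
    using T(1) c(2) unfolding gms
    by (simp add: assoc layer_cancel layer_square) (simp add: expand unitary_cancel)
  moreover have "\<dots> \<in> impl 1"
    using T c gms_impl[OF S] layer
    by (intro impl_smult impl_mult_local(1)[OF T(2)] impl_mult_local(2)[OF _ layer] impl_mult_local(1)[OF layer]) auto
  ultimately show ?thesis by simp
qed

lemma unitary_smult_inj:
  assumes "unitary A" "a \<cdot>\<^sub>m A = b \<cdot>\<^sub>m A"
  shows "a = b"
proof -
  have "mat_adjoint A * (a \<cdot>\<^sub>m A) = mat_adjoint A * (b \<cdot>\<^sub>m A)"
    using assms by simp
  then have "a \<cdot>\<^sub>m 1\<^sub>m (2 ^ n) = b \<cdot>\<^sub>m (1\<^sub>m (2 ^ n))"
    using assms(1) by (simp add: expand unitary_cancel)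
  from arg_cong[OF this, of "\<lambda>A. A $$ (0, 0)"] show ?thesis by simp
qed

text \<open>Local unitaries diagonalize \<open>A\<close> to a phase \<open>e\<close> times Z on a
  set \<open>S\<close>, which reduces the claim to \<open>rot_zs_impl\<close>.\<close>

lemma rot_impl:
  assumes A: "A \<in> pauli" "mat_adjoint A = (- 1) \<cdot>\<^sub>m A"
  shows "rot A \<in> impl 1"
proof -
  obtain u where u: "A = tensor n u" "\<And>i. i < n \<Longrightarrow> u i \<in> pauli1"
    using pauliE[OF A(1)] by metis
  have "\<forall>i. \<exists>c h b. i < n \<longrightarrow> cmod c = 1 \<and> q1.unitary h \<and>
      u i = c \<cdot>\<^sub>m (h * ((if b then pauli_Z else 1\<^sub>m 2) * mat_adjoint h))"
    using pauli1_diagonalize u(2) by metis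
  then obtain c h b where chb: "\<And>i. i < n \<Longrightarrow> cmod (c i) = 1" "\<And>i. i < n \<Longrightarrow> q1.unitary (h i)"
    "\<And>i. i < n \<Longrightarrow> u i = c i \<cdot>\<^sub>m (h i * ((if b i then pauli_Z else 1\<^sub>m 2) * mat_adjoint (h i)))"
    by metis
  define S where "S = {i. i < n \<and> b i}"
  define U where "U = tensor n h"
  define e where "e = (\<Prod>i<n. c i)"
  have S: "S \<subseteq> {..<n}"
    by (auto simp: S_def)
  have U: "unitary U" "U \<in> impl 0" "mat_adjoint U \<in> impl 0"
    using chb(2) unfolding U_def
    by (simp_all add: tensor_unitary tensor_adjoint tensor_impl q1.unitary_adjoint)
  have zs: "zs S = tensor n (\<lambda>i. if b i then pauli_Z else 1\<^sub>m 2)"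
    unfolding zs_def S_def by (rule tensor_cong) simp
  have A_eq: "A = e \<cdot>\<^sub>m (U * (zs S * mat_adjoint U))"
  proof -
    have "A = tensor n (\<lambda>i. c i \<cdot>\<^sub>m (h i * ((if b i then pauli_Z else 1\<^sub>m 2) * mat_adjoint (h i))))"
      unfolding u(1) by (rule tensor_cong) (rule chb(3))
    also have "\<dots> = e \<cdot>\<^sub>m tensor n (\<lambda>i. h i * ((if b i then pauli_Z else 1\<^sub>m 2) * mat_adjoint (h i)))"
      unfolding e_def using chb(2) by (intro tensor_smult) simp
    also have "tensor n (\<lambda>i. h i * ((if b i then pauli_Z else 1\<^sub>m 2) * mat_adjoint (h i))) = U * (zs S * mat_adjoint U)"
      using chb(2) by (simp add: U_def zs tensor_adjoint tensor_mult)
    finally show ?thesis .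
  qed
  have herm: "mat_adjoint (zs S) = zs S"
    unfolding zs_def
    by (subst tensor_adjoint, simp, rule tensor_cong) (simp add: pauli2 adjoint2 one2)
  have zs_unitary: "unitary (zs S)"
    by (rule pauli_unitary[OF zs_pauli])
  have "cnj e \<cdot>\<^sub>m (U * (zs S * mat_adjoint U)) = (- e) \<cdot>\<^sub>m (U * (zs S * mat_adjoint U))"
    using A(2) U(1) unfolding A_eq by (simp add: adjoint herm expand)
  \<comment> \<open>Antihermiticity makes \<open>e\<close> imaginary; being of modulus 1, it is i or
    -i.\<close>
  then have "cnj e = - e"
    by (rule unitary_smult_inj[rotated]) (intro unitary_mult unitary_adjoint U zs_unitary)
  moreover have "cmod e = 1"
    using chb(1) by (simp add: e_def flip: prod_norm)
  ultimately have "e = \<i> \<or> e = - \<i>"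
    by (auto simp: complex_eq_iff cmod_def real_sqrt_eq_1_iff power2_eq_1_iff)
  \<comment> \<open>Since Z_S squares to 1, 1 - i Z_S = -i Z_S (1 + i Z_S): the two signs differ by
    a local Pauli operator.\<close>
  moreover have "rot ((- \<i>) \<cdot>\<^sub>m zs S) = (- \<i>) \<cdot>\<^sub>m (zs S * rot (\<i> \<cdot>\<^sub>m zs S))"
    using unitary_cancel(1)[OF zs_unitary]
    by (simp add: rot_def herm expand) (auto intro!: eqI)
  ultimately have "rot (e \<cdot>\<^sub>m zs S) \<in> impl 1"
    using rot_zs_impl[OF S] pauli_impl[OF zs_pauli] impl_smult impl_mult_local(1) by auto
  moreover have "rot A = U * (rot (e \<cdot>\<^sub>m zs S) * mat_adjoint U)"
    using U(1) unfolding A_eq rot_def by (simp add: expand unitary_cancel)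
  ultimately show ?thesis
    using U(2,3) impl_mult_local by simp
qed

end

section \<open>Clifford operations\<close>

context qubits
begin

context
  assumes n: "0 < n"
begin

text \<open>Defined through the action on Pauli operators instead of by generators, since the
  synthesis works only with that action.\<close>

definition clifford :: "complex mat set" where
  "clifford = {K. unitary K \<and> (\<forall>P\<in>pauli. conj K P \<in> pauli)}"

lemma clifford_unitary: "K \<in> clifford \<Longrightarrow> unitary K"
  by (simp add: clifford_def)

lemma clifford_conj: "K \<in> clifford \<Longrightarrow> P \<in> pauli \<Longrightarrow> conj K P \<in> pauli"
  by (simp add: clifford_def)

lemma clifford_mult: "K \<in> clifford \<Longrightarrow> L \<in> clifford \<Longrightarrow> K * L \<in> clifford"
  by (auto simp: clifford_def conj_compose unitary_mult)

lemma clifford_smult: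
  assumes "K \<in> clifford" "cmod c = 1"
  shows "c \<cdot>\<^sub>m K \<in> clifford"
proof -
  have K: "unitary K" "unitary (c \<cdot>\<^sub>m K)"
    using assms by (auto intro: unitary_smult clifford_unitary)
  have "conj (c \<cdot>\<^sub>m K) P = conj K P" if "P \<in> pauli" for P
    using that K by (intro conj_eqI) (simp_all add: expand conj_eq)
  then show ?thesis
    using K assms by (simp add: clifford_def)
qed

lemma pauli_clifford:
  assumes "P \<in> pauli"
  shows "P \<in> clifford"
proof -
  have "conj P Q \<in> pauli" if Q: "Q \<in> pauli" for Q
    using pauli_twist[OF assms Q]
  proof
    assume "comm P Q"
    then show ?thesis
      using assms Q by (simp add: conj_comm pauli_unitary)
  next
    assume "anti P Q"
    then have "conj P Q = (- 1) \<cdot>\<^sub>m Q"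
      using assms Q by (intro conj_eqI) (simp_all add: pauli_unitary twist_def expand)
    then show ?thesis
      using Q by (simp add: pauli_smult n)
  qed
  then show ?thesis
    using assms by (simp add: clifford_def pauli_unitary)
qed

text \<open>Commuting Pauli operators are fixed and an anticommuting \<open>Q\<close> goes to
  \<open>- A Q\<close>. Gates are therefore recognized as Clifford by writing them as products of
  such rotations.\<close>

lemma rot_clifford:
  assumes A: "A \<in> pauli" "mat_adjoint A = (- 1) \<cdot>\<^sub>m A"
  shows "rot A \<in> clifford"
proof -
  have "conj (rot A) Q \<in> pauli" if Q: "Q \<in> pauli" for Q
    using pauli_twist[OF A(1) Q]
  proof
    assume "comm A Q"
    then show ?thesis
      using A Q by (simp add: conj_comm rot_comm unitary_rot pauli_unitary)
  next
    assume "anti A Q"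
    then show ?thesis
      using A Q by (simp add: rot_anti pauli_unitary pauli_mult pauli_smult n)
  qed
  then show ?thesis
    using A by (simp add: clifford_def unitary_rot pauli_unitary)
qed

declare clifford_unitary [simp]

lemma adjoint_rot: "A \<in> M \<Longrightarrow> mat_adjoint A = (- 1) \<cdot>\<^sub>m A \<Longrightarrow> mat_adjoint (rot A) = rot ((- 1) \<cdot>\<^sub>m A)"
  by (simp add: rot_def adjoint)

lemma antihermitian_smult: "A \<in> M \<Longrightarrow> hermitian A \<Longrightarrow> mat_adjoint (c \<cdot>\<^sub>m A) = (- 1) \<cdot>\<^sub>m (c \<cdot>\<^sub>m A)" if "cnj c = - c"
  using that by (simp add: adjoint hermitian_def expand)

lemma hermitian_square: "unitary A \<Longrightarrow> hermitian A \<Longrightarrow> A * A = 1\<^sub>m (2 ^ n)"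
  using unitary_cancel(1)[of A] by (simp add: hermitian_def)

lemma hermitian_mult: "A \<in> M \<Longrightarrow> B \<in> M \<Longrightarrow> hermitian A \<Longrightarrow> hermitian B \<Longrightarrow> comm A B \<Longrightarrow> hermitian (A * B)"
  by (simp add: hermitian_def adjoint comm_iff)

subsection \<open>The Clifford gates\<close>

text \<open>X X = 1 gives (X + Z) / sqrt 2 = X (1 + X Z) / sqrt 2, a Pauli operator times a
  rotation.\<close>

lemma hadamard_gate_clifford:
  assumes "i < n"
  shows "on_qubit n i hadamard \<in> clifford"
proof -
  note * = XZ_pauli[OF assms] XZ_hermitian XZ_anti[OF assms]
  have "on_qubit n i hadamard = complex_of_real (1 / sqrt 2) \<cdot>\<^sub>m (X i + Z i)"
    by (simp add: hadamard_eq on_qubit_smult on_qubit_add)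
  also have "\<dots> = X i * rot (X i * Z i)"
    using XZ_square(1)[OF assms]
    by (simp add: rot_def expand(2-) add_smult_distrib_left_mat flip: assoc)
  also have "\<dots> \<in> clifford"
    using * by (intro clifford_mult pauli_clifford rot_clifford pauli_mult hermitian_anti) auto
  finally show ?thesis .
qed

lemma s_gate_clifford:
  assumes "i < n"
  shows "on_qubit n i s_gate \<in> clifford"
proof -
  have s_eq: "s_gate = cis (pi / 4) \<cdot>\<^sub>m q1.rot ((- \<i>) \<cdot>\<^sub>m pauli_Z)"
  proof -
    have "s_gate \<in> carrier_mat 2 2"
      by (simp add: s_gate_def mat_of_rows_list_def numeral_2_eq_2)
    moreover have "cis (pi / 4) = complex_of_real (1 / sqrt 2) * (1 + \<i>)"
      by (simp add: complex_eq_iff cos_45 sin_45 field_simps)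
    moreover have "complex_of_real (sqrt 2) * complex_of_real (sqrt 2) = 2"
      by (simp flip: of_real_mult)
    ultimately show ?thesis
      by (intro eqI2) (simp_all add: q1.rot_def pauli2, simp_all add: s_gate_def mat_of_rows_list_def field_simps)
  qed
  have "on_qubit n i s_gate = cis (pi / 4) \<cdot>\<^sub>m rot ((- \<i>) \<cdot>\<^sub>m Z i)"
    unfolding s_eq using assms by (simp add: on_qubit_smult on_qubit_add on_qubit_one q1.rot_def rot_def)
  also have "\<dots> \<in> clifford"
    using XZ_pauli(2)[OF assms] XZ_hermitian
    by (intro clifford_smult rot_clifford pauli_smult n antihermitian_smult) auto
  finally show ?thesis .
qed

text \<open>The operator is -1 on the common (-1)-eigenspace of \<open>A\<close> and
  \<open>B\<close> and 1 on the other joint eigenspaces: CZ for two Z operators, CNOT for Z on the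
  control and X on the target. Up to a phase it is a product of three rotations.\<close>

lemma controlled_clifford:
  assumes AB: "A \<in> pauli" "B \<in> pauli" and herm: "hermitian A" "hermitian B" and comm: "comm A B"
  shows "(1 / 2) \<cdot>\<^sub>m (1\<^sub>m (2 ^ n) + (A + (B + (- 1) \<cdot>\<^sub>m (A * B)))) \<in> clifford"
proof -
  let ?C = "1\<^sub>m (2 ^ n) + (A + (B + (- 1) \<cdot>\<^sub>m (A * B)))"
  have M: "A \<in> M" "B \<in> M" using AB by auto
  have sq: "A * A = 1\<^sub>m (2 ^ n)" "B * B = 1\<^sub>m (2 ^ n)"
    using AB herm by (auto intro: hermitian_square pauli_unitary)
  have A: "A * (A * C) = C" "B * (B * C) = C" if "C \<in> M" for C
    using M sq that by (simp_all add: expand flip: assoc)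
  have BA: "B * A = A * B" "B * (A * C) = A * (B * C)" if "C \<in> M" for C
    using comm M that by (simp_all add: comm_iff flip: assoc)
  have "(1\<^sub>m (2 ^ n) + (- \<i>) \<cdot>\<^sub>m A) * ((1\<^sub>m (2 ^ n) + (- \<i>) \<cdot>\<^sub>m B) * (1\<^sub>m (2 ^ n) + \<i> \<cdot>\<^sub>m (A * B))) = (1 - \<i>) \<cdot>\<^sub>m ?C"
    using M sq A BA[of A] BA[of B] by (simp add: expand) (auto intro!: eqI simp: algebra_simps)
  then have "rot ((- \<i>) \<cdot>\<^sub>m A) * (rot ((- \<i>) \<cdot>\<^sub>m B) * rot (\<i> \<cdot>\<^sub>m (A * B))) =
      (complex_of_real (1 / sqrt 2) * complex_of_real (1 / sqrt 2) * complex_of_real (1 / sqrt 2) * (1 - \<i>)) \<cdot>\<^sub>m ?C"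
    using M by (simp add: rot_def expand(4,5,7) mult.assoc)
  \<comment> \<open>The phase cis (pi/4) = (1 + i) / sqrt 2 cancels the 1 - i and supplies the
    fourth factor 1 / sqrt 2.\<close>
  moreover have "cis (pi / 4) * (complex_of_real (1 / sqrt 2) * complex_of_real (1 / sqrt 2) * complex_of_real (1 / sqrt 2) * (1 - \<i>)) = 1 / 2"
  proof -
    have "cis (pi / 4) = complex_of_real (1 / sqrt 2) * (1 + \<i>)"
      by (simp add: complex_eq_iff cos_45 sin_45 field_simps)
    then have "cis (pi / 4) * (complex_of_real (1 / sqrt 2) * complex_of_real (1 / sqrt 2) * complex_of_real (1 / sqrt 2) * (1 - \<i>)) =
      (complex_of_real (1 / sqrt 2) * complex_of_real (1 / sqrt 2)) * (complex_of_real (1 / sqrt 2) * complex_of_real (1 / sqrt 2)) * ((1 + \<i>) * (1 - \<i>))"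
      by (simp only: mult_ac)
    also have "\<dots> = 1 / 2"
      unfolding half_sqrt by (simp add: algebra_simps)
    finally show ?thesis .
  qed
  ultimately have "(1 / 2) \<cdot>\<^sub>m ?C = cis (pi / 4) \<cdot>\<^sub>m
      (rot ((- \<i>) \<cdot>\<^sub>m A) * (rot ((- \<i>) \<cdot>\<^sub>m B) * rot (\<i> \<cdot>\<^sub>m (A * B))))"
    using M by (simp only: expand(7) closed)
  also have "\<dots> \<in> clifford"
    using AB M herm comm
    by (intro clifford_smult clifford_mult rot_clifford pauli_smult n antihermitian_smult pauli_mult hermitian_mult) auto
  finally show ?thesis .
qed

lemma cz_gate_clifford:
  assumes "a < n" "b < n" "a \<noteq> b"
  shows "cz_gate n a b \<in> clifford"
proof -
  have "cz_gate n a b = (1 / 2) \<cdot>\<^sub>m (1\<^sub>m (2 ^ n) + (Z a + (Z b + (- 1) \<cdot>\<^sub>m (Z a * Z b))))"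
    using assms by (intro eqI) (auto simp: cz_gate_def Z_mult_index Z_index)
  also have "\<dots> \<in> clifford"
    using assms by (intro controlled_clifford XZ_pauli XZ_hermitian on_qubit_comm) auto
  finally show ?thesis .
qed

lemma cnot_gate_clifford:
  assumes "c < n" "t < n" "c \<noteq> t"
  shows "cnot_gate n c t \<in> clifford"
proof -
  have "flip_bit t y \<noteq> y" for y :: nat
    by (metis bit_flip_bit_iff possible_bit_nat)
  then have "cnot_gate n c t = (1 / 2) \<cdot>\<^sub>m (1\<^sub>m (2 ^ n) + (Z c + (X t + (- 1) \<cdot>\<^sub>m (Z c * X t))))"
    using assms
    by (intro eqI) (auto simp: cnot_gate_def Z_mult_index Z_index X_index bit_flip_bit_iff)
  also have "\<dots> \<in> clifford"
    using assms by (intro controlled_clifford XZ_pauli XZ_hermitian on_qubit_comm) auto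
  finally show ?thesis .
qed

lemma input_gate_clifford:
  assumes "valid_input_gate n g" "\<not> is_z_phase g"
  shows "input_gate_mat n g \<in> clifford"
  using assms
  by (cases g) (auto intro: s_gate_clifford hadamard_gate_clifford cz_gate_clifford cnot_gate_clifford)

section \<open>Single-qubit rotations and unitarity of input circuits\<close>

lemma rotation_unitary:
  assumes "A \<in> carrier_mat 2 2" "A * A = 1\<^sub>m 2" "mat_adjoint A = A"
  shows "q1.unitary (complex_of_real (cos t) \<cdot>\<^sub>m 1\<^sub>m 2 + (- \<i> * complex_of_real (sin t)) \<cdot>\<^sub>m A)"
proof (rule q1.unitaryI)
  have "complex_of_real (cos t) * complex_of_real (cos t) + complex_of_real (sin t) * complex_of_real (sin t) = 1"
    by (simp only: sin_cos_squared_add3 of_real_1 flip: of_real_mult of_real_add)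
  then show "mat_adjoint (complex_of_real (cos t) \<cdot>\<^sub>m 1\<^sub>m 2 + (- \<i> * complex_of_real (sin t)) \<cdot>\<^sub>m A) *
      (complex_of_real (cos t) \<cdot>\<^sub>m 1\<^sub>m 2 + (- \<i> * complex_of_real (sin t)) \<cdot>\<^sub>m A) = 1\<^sub>m 2"
    using assms by (simp add: q1.adjoint q1.expand) (auto intro!: q1.eqI simp: algebra_simps)
qed (use assms in simp)

text \<open>This makes a phase rotation free of GMS gates once its axis is one of the generators
  X_j, Z_j.\<close>

lemma rotation_gate:
  assumes "j < n" "T = X j \<or> T = Z j"
  obtains A where "q1.unitary A"
    "complex_of_real (cos t) \<cdot>\<^sub>m 1\<^sub>m (2 ^ n) + (- \<i> * complex_of_real (sin t)) \<cdot>\<^sub>m T = on_qubit n j A"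
proof -
  obtain B where B: "B = pauli_X \<or> B = pauli_Z" "T = on_qubit n j B"
    using assms(2) by blast
  then have "B \<in> carrier_mat 2 2" "B * B = 1\<^sub>m 2" "mat_adjoint B = B"
    by (auto simp: pauli2 mult2 one2 adjoint2)
  then show ?thesis
    using assms(1) by (intro that[OF rotation_unitary[of B t]]) (simp_all add: B(2) on_qubit_add on_qubit_smult on_qubit_one)
qed

lemma input_gate_unitary:
  assumes "valid_input_gate n g"
  shows "unitary (input_gate_mat n g)"
proof (cases g)
  case (Z_Phase i \<alpha>)
  then have "i < n" using assms by simp
  with rotation_gate[of i "Z i" "\<alpha> / 2"] show ?thesis
    by (metis Z_Phase input_gate_mat.simps(5) z_phase_eq on_qubit_unitary)
qed (use assms input_gate_clifford[of g] in auto)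

lemma input_circuit_unitary:
  assumes "input_circuit n C"
  shows "unitary (circuit_mat n input_gate_mat C)"
  using assms
proof (induction C rule: rev_induct)
  case Nil
  show ?case by (simp add: circuit_mat_def unitary_one)
next
  case (snoc g C)
  then show ?case
    by (auto simp: circuit_mat_snoc input_circuit_def intro!: unitary_mult input_gate_unitary)
qed

section \<open>Moving Pauli operators by rotations\<close>

lemma not_comm_anti:
  assumes "unitary A" "unitary B" "comm A B"
  shows "\<not> anti A B"
proof
  assume "anti A B"
  then have "1 \<cdot>\<^sub>m (B * A) = (- 1) \<cdot>\<^sub>m (B * A)"
    using assms by (simp add: twist_def)
  then show False
    using unitary_smult_inj[OF unitary_mult[OF assms(2,1)]] by fastforce
qed

text \<open>Otherwise \<open>P\<close> commutes with every generator and is a scalar, contradicting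
  that it anticommutes with \<open>Q\<close>.\<close>

lemma anticommuting_generator:
  assumes P: "P \<in> pauli" and Q: "Q \<in> pauli" "anti P Q"
  obtains j T where "j < n" "T = X j \<or> T = Z j" "anti P T"
proof (rule ccontr)
  note result = that
  assume "\<not> thesis"
  then have comm: "comm P (X j)" "comm P (Z j)" if "j < n" for j
    using result[OF that] pauli_twist[OF P] XZ_pauli[OF that] by blast+
  obtain A where A: "P = on_qubit n n A"
    using commutant[of P n] comm P by (metis pauli_M)
  \<comment> \<open>\<open>commutant\<close> was used with the out-of-range qubit \<open>n\<close>;
    bit \<open>n\<close> of every index is clear, so only the entry (0, 0) of \<open>A\<close>
    occurs.\<close>
  have "P = A $$ (0, 0) \<cdot>\<^sub>m 1\<^sub>m (2 ^ n)"
  proof (rule eqI)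
    fix x y :: nat assume xy: "x < 2 ^ n" "y < 2 ^ n"
    then have "\<not> bit x n" "\<not> bit y n" "x = y \<longleftrightarrow> (\<forall>j<n. j \<noteq> n \<longrightarrow> bit x j = bit y j)"
      using bit_less_exp bits_eqI[OF xy] by blast+
    then show "P $$ (x, y) = (A $$ (0, 0) \<cdot>\<^sub>m 1\<^sub>m (2 ^ n)) $$ (x, y)"
      unfolding A on_qubit_index[OF xy] using xy by auto
  qed (use P in auto)
  then have "comm P Q"
    using Q(1) by (simp add: comm_iff expand)
  then show False
    using not_comm_anti assms by (blast intro: pauli_unitary)
qed

text \<open>With P = conj K R and W = rot (T P), \<open>rot_exchange\<close> gives W P = T W, so L =
  K W^-1 pulls \<open>R\<close> back to \<open>T\<close>. If \<open>R\<close> and \<open>T\<close>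
  have the same sign against \<open>G\<close>, then T P, hence W, commutes with \<open>G\<close>;
  this preserves what earlier steps achieved.\<close>

lemma exchange:
  assumes K: "K \<in> clifford" and R: "R \<in> pauli" "hermitian R" and T: "T \<in> pauli" "hermitian T"
    and anti: "anti T (conj K R)"
  obtains L where "L \<in> clifford" "K = L * rot (T * conj K R)" "rot (T * conj K R) \<in> impl 1" "conj L R = T"
    "\<And>G \<epsilon>. G \<in> M \<Longrightarrow> comm K G \<Longrightarrow> twist \<epsilon> R G \<Longrightarrow> twist \<epsilon> T G \<Longrightarrow> \<epsilon> * \<epsilon> = 1 \<Longrightarrow> comm L G"
proof
  define P where "P = conj K R"
  define W where "W = rot (T * P)"
  have P: "P \<in> pauli" "hermitian P"
    using K R by (auto simp: P_def intro: clifford_conj hermitian_conj)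
  have TP: "T * P \<in> pauli" "mat_adjoint (T * P) = (- 1) \<cdot>\<^sub>m (T * P)"
    using T P anti by (auto simp: P_def intro!: pauli_mult hermitian_anti)
  have W: "unitary W" "W \<in> impl 1"
    using unitary_rot[OF pauli_unitary TP(2)] rot_impl[OF TP] TP unfolding W_def by auto
  have WW: "mat_adjoint W \<in> clifford"
    unfolding W_def using TP
    by (simp add: adjoint_rot) (intro rot_clifford pauli_smult n; simp add: adjoint expand)
  let ?L = "K * mat_adjoint W"
  show L: "?L \<in> clifford"
    using K WW by (rule clifford_mult)
  show "rot (T * conj K R) \<in> impl 1"
    using W by (simp add: W_def P_def)
  show "K = ?L * rot (T * conj K R)"
    using K W by (simp add: assoc unitary_cancel expand flip: P_def W_def)
  have WP: "W * P = T * W"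
    unfolding W_def using T P by (intro rot_exchange) (auto intro: pauli_unitary)
  have "conj ?L R = conj (mat_adjoint W) P"
    using K W R by (simp add: conj_compose unitary_adjoint P_def)
  also have "\<dots> = W * P * mat_adjoint W"
    using W P by (simp add: conj_def adjoint assoc)
  also have "\<dots> = T"
    unfolding WP using W T by (simp add: assoc unitary_cancel expand)
  finally show "conj ?L R = T" .
  fix G \<epsilon> assume G: "G \<in> M" "comm K G" "twist \<epsilon> R G" "twist \<epsilon> T G" "\<epsilon> * \<epsilon> = 1"
  \<comment> \<open>As \<open>conj K G = G\<close>, the sign of \<open>R\<close> against
    \<open>G\<close> passes to \<open>P\<close>.\<close>
  have "twist \<epsilon> (conj K R) (conj K G)"
    using K R G by (intro twist_conj) auto
  then have "twist \<epsilon> P G"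
    using K G by (simp add: P_def conj_comm)
  then have "twist (\<epsilon> * \<epsilon>) (T * P) G"
    using T P G by (intro twist_mult_left) auto
  then have "comm W G"
    unfolding W_def using T P G by (intro rot_comm) auto
  then have "comm (mat_adjoint W) G"
    using W G by (intro comm_adjoint)
  then have "twist (1 * 1) ?L G"
    using K W G by (intro twist_mult_left) auto
  then show "comm ?L G" by simp
qed

section \<open>Splitting a circuit into a Clifford operation and rotations\<close>

text \<open>A Clifford gate joins \<open>K\<close>; a phase gate is carried through \<open>K\<close>
  to \<open>V\<close> at the cost of one rotation.\<close>

lemma circuit_split:
  assumes "input_circuit n C"
  shows "\<exists>K V. K \<in> clifford \<and> V \<in> impl (length (filter is_z_phase C)) \<and>
    circuit_mat n input_gate_mat C = K * V"
  using assms
proof (induction C rule: rev_induct)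
  case Nil
  have "1\<^sub>m (2 ^ n) \<in> clifford" "1\<^sub>m (2 ^ n) \<in> impl 0"
    by (auto intro: pauli_clifford one_pauli impl_one)
  then show ?case
    by (intro exI[of _ "1\<^sub>m (2 ^ n)"]) (simp add: circuit_mat_def expand)
next
  case (snoc g C)
  then obtain K V where KV: "K \<in> clifford" "V \<in> impl (length (filter is_z_phase C))"
    "circuit_mat n input_gate_mat C = K * V"
    by (auto simp: input_circuit_def)
  have g: "valid_input_gate n g"
    using snoc.prems by (simp add: input_circuit_def)
  have M: "K \<in> M" "V \<in> M"
    using KV impl_closed by auto
  show ?case
  proof (cases "is_z_phase g")
    case False
    then have gc: "input_gate_mat n g \<in> clifford"
      using g input_gate_clifford by blast
    then have "circuit_mat n input_gate_mat (C @ [g]) = (input_gate_mat n g * K) * V"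
      using KV M by (simp add: circuit_mat_snoc assoc)
    with KV clifford_mult[OF gc KV(1)] False show ?thesis
      by auto
  next
    case True
    then obtain i \<alpha> where gz: "g = Z_Phase i \<alpha>" by (cases g) auto
    then have i: "i < n" using g by simp
    have R: "Z i \<in> pauli" "hermitian (Z i)"
      using i XZ_pauli XZ_hermitian by auto
    \<comment> \<open>The image of Z_i anticommutes with that of X_i, so it also anticommutes with
      some generator \<open>T\<close>.\<close>
    have "anti (conj K (Z i)) (conj K (X i))"
      using i KV(1) XZ_anti by (intro twist_conj) auto
    then obtain j T where T: "j < n" "T = X j \<or> T = Z j" "anti (conj K (Z i)) T"
      using anticommuting_generator i KV(1) XZ_pauli clifford_conj by metis
    have T': "T \<in> pauli" "hermitian T"
      using T XZ_pauli XZ_hermitian by auto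
    have "anti T (conj K (Z i))"
      using T(3) T' R KV(1) by (intro twist_sym[of "conj K (Z i)" T]) auto
    then obtain L W where L: "L \<in> clifford" "K = L * W" "W \<in> impl 1" "conj L (Z i) = T"
      using exchange[OF KV(1) R T'] by metis
    obtain A where A: "q1.unitary A" "complex_of_real (cos (\<alpha> / 2)) \<cdot>\<^sub>m 1\<^sub>m (2 ^ n) +
        (- \<i> * complex_of_real (sin (\<alpha> / 2))) \<cdot>\<^sub>m T = on_qubit n j A"
      using rotation_gate[OF T(1,2)] by metis
    \<comment> \<open>Passing through \<open>L\<close> turns the axis Z_i into \<open>T\<close>, and
      the phase gate into a gate on qubit \<open>j\<close>.\<close>
    have "Z i * L = L * T"
      using conj_eq[of L "Z i"] L by simp
    then have "z_phase n i \<alpha> * L = L * on_qubit n j A"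
      using L T' unfolding z_phase_eq[OF i] A(2)[symmetric] by (simp add: expand)
    then have "z_phase n i \<alpha> * L * W * V = L * (on_qubit n j A * W * V)"
      using L M impl_closed[OF L(3)] by (simp add: assoc z_phase_eq[OF i])
    then have "circuit_mat n input_gate_mat (C @ [g]) = L * (on_qubit n j A * W * V)"
      using KV(3) L M impl_closed[OF L(3)] gz by (simp add: circuit_mat_snoc assoc z_phase_eq[OF i])
    moreover have "on_qubit n j A * W * V \<in> impl (1 + length (filter is_z_phase C))"
      using on_qubit_impl[OF T(1) A(1)] L KV by (intro impl_mult impl_mult_local(1))
    ultimately show ?thesis
      using L(1) True by auto
  qed
qed

section \<open>Synthesis of Clifford operations\<close>

text \<open>Locality on the qubits below \<open>k\<close>, phrased through commutation because
  \<open>exchange\<close> transports exactly that.\<close>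

definition acts_below :: "nat \<Rightarrow> complex mat \<Rightarrow> bool" where
  "acts_below k K \<longleftrightarrow> (\<forall>j. k \<le> j \<and> j < n \<longrightarrow> comm K (X j) \<and> comm K (Z j))"

lemma acts_belowD:
  assumes "acts_below k K" "k \<le> j" "j < n" "G = X j \<or> G = Z j"
  shows "comm K G"
  using assms by (auto simp: acts_below_def)

lemma on_qubit_XZ_comm:
  assumes "i < n" "j < n" "i \<noteq> j" "G = X j \<or> G = Z j" "A \<in> carrier_mat 2 2"
  shows "comm (on_qubit n i A) G"
  using assms by (auto intro: on_qubit_comm)

text \<open>If the image \<open>P\<close> of Z_k anticommutes with Z_k, one exchange suffices.
  Otherwise two exchanges pass through a \<open>T\<close> that anticommutes with both and acts
  trivially above \<open>k\<close>.\<close>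

lemma fix_Z:
  assumes K: "K \<in> clifford" "acts_below (Suc k) K" and k: "k < n"
  obtains L W where "L \<in> clifford" "W \<in> impl 2" "K = L * W" "conj L (Z k) = Z k" "acts_below (Suc k) L"
proof -
  define P where "P = conj K (Z k)"
  have P: "P \<in> pauli"
    using K k by (simp add: P_def clifford_conj XZ_pauli)
  have Zk: "Z k \<in> pauli" "hermitian (Z k)" and Xk: "X k \<in> pauli" "hermitian (X k)"
    using k XZ_pauli XZ_hermitian by auto
  have above: "comm (on_qubit n i A) G" if "i \<le> k" "Suc k \<le> j" "j < n" "G = X j \<or> G = Z j" "A \<in> carrier_mat 2 2" for i j A G
    using that k by (intro on_qubit_XZ_comm[of i j]) auto
  show thesis
  proof (cases "anti P (Z k)")
    case True
    then have "anti (Z k) (conj K (Z k))"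
      unfolding P_def[symmetric] using P Zk by (intro twist_sym[of P "Z k"]) auto
    then obtain L W where L: "L \<in> clifford" "K = L * W" "W \<in> impl 1" "conj L (Z k) = Z k"
      "\<And>G \<epsilon>. G \<in> M \<Longrightarrow> comm K G \<Longrightarrow> twist \<epsilon> (Z k) G \<Longrightarrow> twist \<epsilon> (Z k) G \<Longrightarrow> \<epsilon> * \<epsilon> = 1 \<Longrightarrow> comm L G"
      using exchange[OF K(1) Zk Zk] by metis
    have "acts_below (Suc k) L"
      unfolding acts_below_def
      using acts_belowD[OF K(2)] above[of k] by (auto intro!: L(5)[of _ 1])
    with L impl_mono[of W 1 2] show thesis
      by (intro that[of L W]) auto
  next
    case False
    then have PZ: "comm P (Z k)"
      using pauli_twist[OF P Zk(1)] by blast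
    obtain T where T: "T \<in> pauli" "hermitian T" "anti T P" "anti T (Z k)" "acts_below (Suc k) T"
    proof (cases "anti P (X k)")
      case True
      show thesis
      proof (rule that[of "X k"])
        show "anti (X k) P"
          using P Xk True by (intro twist_sym[of P "X k"]) auto
        show "acts_below (Suc k) (X k)"
          using above[of k] by (auto simp: acts_below_def)
      qed (use Xk XZ_anti k in auto)
    next
      case False
      then have PX: "comm P (X k)"
        using pauli_twist[OF P Xk(1)] by blast
      \<comment> \<open>\<open>P\<close> anticommutes with some Pauli operator, so some generator
        \<open>g\<close> anticommutes with \<open>P\<close>; it will be attached to X_k.\<close>
      have "anti P (conj K (X k))"
        unfolding P_def using K k XZ_anti by (intro twist_conj) auto
      then obtain j g where g: "j < n" "g = X j \<or> g = Z j" "anti P g"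
        using anticommuting_generator P K(1) Xk clifford_conj by metis
      have g': "g \<in> pauli" "hermitian g"
        using g XZ_pauli XZ_hermitian by auto
      have ncomm: "\<not> comm P g"
        using not_comm_anti P g' g(3) pauli_unitary by blast
      have "j \<noteq> k"
        using ncomm PX PZ g(2) by auto
      moreover have "\<not> k < j"
      proof
        assume "k < j"
        \<comment> \<open>Above \<open>k\<close> both \<open>K\<close> and Z_k commute with
          \<open>g\<close>, hence so would \<open>P\<close>.\<close>
        then have "comm K g" "comm (Z k) g"
          using acts_belowD[OF K(2) _ g(1,2)] above[OF _ _ g(1,2)] by auto
        then have "comm P g"
          unfolding P_def using K g' conj_comm[of K g] twist_conj[of K "Z k" g 1] by simp
        with ncomm show False ..
      qed
      ultimately have j: "j < k" by simp
      have Xg: "comm (X k) g"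
        using g j k by (intro on_qubit_XZ_comm) auto
      show thesis
      \<comment> \<open>The factor \<open>g\<close> anticommutes with \<open>P\<close> while X_k
        commutes with it; against Z_k the roles are reversed.\<close>
      proof (rule that[of "X k * g"])
        show "X k * g \<in> pauli"
          using Xk g' by (intro pauli_mult)
        show "hermitian (X k * g)"
          using Xk g' Xg by (intro hermitian_mult) auto
        have "twist (1 * - 1) (X k * g) P"
          using P Xk g' g(3) PX by (intro twist_mult_left twist_sym[of P]) auto
        then show "anti (X k * g) P" by simp
        have "comm (Z k) g"
          using g j k by (intro on_qubit_XZ_comm) auto
        then have "comm g (Z k)"
          using g' Zk by (intro twist_sym[of "Z k" g]) auto
        then have "twist (- 1 * 1) (X k * g) (Z k)"
          using g' XZ_anti k by (intro twist_mult_left) auto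
        then show "anti (X k * g) (Z k)" by simp
        have "comm (X k * g) G" if "Suc k \<le> i" "i < n" "G = X i \<or> G = Z i" for i G
        proof -
          have "comm (X k) G" "comm g G"
            using above[of k i G] above[of j i G] that g j by auto
          then have "twist (1 * 1) (X k * g) G"
            using g' that by (intro twist_mult_left) auto
          then show ?thesis by simp
        qed
        then show "acts_below (Suc k) (X k * g)"
          by (auto simp: acts_below_def)
      qed
    qed
    obtain L1 W1 where L1: "L1 \<in> clifford" "K = L1 * W1" "W1 \<in> impl 1" "conj L1 (Z k) = T"
      "\<And>G \<epsilon>. G \<in> M \<Longrightarrow> comm K G \<Longrightarrow> twist \<epsilon> (Z k) G \<Longrightarrow> twist \<epsilon> T G \<Longrightarrow> \<epsilon> * \<epsilon> = 1 \<Longrightarrow> comm L1 G"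
      using exchange[OF K(1) Zk T(1,2)] T(3) unfolding P_def by metis
    have L1_below: "acts_below (Suc k) L1"
      unfolding acts_below_def
      using acts_belowD[OF K(2)] acts_belowD[OF T(5)] above[of k] by (auto intro!: L1(5)[of _ 1])
    have "anti (Z k) (conj L1 (Z k))"
      unfolding L1(4) using T Zk by (intro twist_sym[of T]) auto
    then obtain L2 W2 where L2: "L2 \<in> clifford" "L1 = L2 * W2" "W2 \<in> impl 1" "conj L2 (Z k) = Z k"
      "\<And>G \<epsilon>. G \<in> M \<Longrightarrow> comm L1 G \<Longrightarrow> twist \<epsilon> (Z k) G \<Longrightarrow> twist \<epsilon> (Z k) G \<Longrightarrow> \<epsilon> * \<epsilon> = 1 \<Longrightarrow> comm L2 G"
      using exchange[OF L1(1) Zk Zk] by metis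
    have "acts_below (Suc k) L2"
      unfolding acts_below_def
      using acts_belowD[OF L1_below] above[of k] by (auto intro!: L2(5)[of _ 1])
    moreover have "W2 * W1 \<in> impl 2"
      using impl_mult[OF L2(3) L1(3)] by (simp add: numeral_2_eq_2)
    moreover have "K = L2 * (W2 * W1)"
      unfolding L1(2) L2(2) using L2 L1 impl_closed by (intro assoc) auto
    ultimately show thesis
      using L2 by (intro that[of L2 "W2 * W1"]) auto
  qed
qed

text \<open>The image \<open>Q\<close> of X_k anticommutes with Z_k. Either it anticommutes with X_k
  and one exchange suffices, or it anticommutes with Y_k and is moved through Y_k; the second move
  is then a rotation about Z_k, which is local.\<close>

lemma fix_X:
  assumes K: "K \<in> clifford" "acts_below (Suc k) K" "conj K (Z k) = Z k" and k: "k < n"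
  obtains L W where "L \<in> clifford" "W \<in> impl 1" "K = L * W" "acts_below k L"
proof -
  have Zk: "Z k \<in> pauli" "hermitian (Z k)" and Xk: "X k \<in> pauli" "hermitian (X k)"
    using k XZ_pauli XZ_hermitian by auto
  have above: "comm (on_qubit n k A) G" if "Suc k \<le> j" "j < n" "G = X j \<or> G = Z j" "A \<in> carrier_mat 2 2" for j A G
    using that k by (intro on_qubit_XZ_comm[of k j]) auto
  have KZ: "comm K (Z k)"
    using conj_eq[of K "Z k"] K by (simp add: comm_iff)
  define Q where "Q = conj K (X k)"
  have Q: "Q \<in> pauli"
    using K Xk by (simp add: Q_def clifford_conj)
  have "anti (conj K (X k)) (conj K (Z k))"
    using K k XZ_anti by (intro twist_conj) auto
  then have QZ: "anti Q (Z k)"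
    using K by (simp add: Q_def)
  have below: "acts_below k L"
    if L: "L \<in> clifford" "conj L (X k) = X k" "comm L (Z k)"
      "\<And>j G. Suc k \<le> j \<Longrightarrow> j < n \<Longrightarrow> G = X j \<or> G = Z j \<Longrightarrow> comm L G" for L
  proof -
    have "comm L (X k)"
      using conj_eq[of L "X k"] L by (simp add: comm_iff)
    then have "comm L (X j) \<and> comm L (Z j)" if "k \<le> j" "j < n" for j
      using that L(3) L(4)[of j] by (cases "j = k") auto
    then show ?thesis
      by (simp add: acts_below_def)
  qed
  show thesis
  proof (cases "anti Q (X k)")
    case True
    then have "anti (X k) (conj K (X k))"
      unfolding Q_def[symmetric] using Q Xk by (intro twist_sym[of Q "X k"]) auto
    then obtain L W where L: "L \<in> clifford" "K = L * W" "W \<in> impl 1" "conj L (X k) = X k"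
      "\<And>G \<epsilon>. G \<in> M \<Longrightarrow> comm K G \<Longrightarrow> twist \<epsilon> (X k) G \<Longrightarrow> twist \<epsilon> (X k) G \<Longrightarrow> \<epsilon> * \<epsilon> = 1 \<Longrightarrow> comm L G"
      using exchange[OF K(1) Xk Xk] by metis
    \<comment> \<open>X_k has sign 1 against the generators above \<open>k\<close> and sign -1
      against Z_k, so commutation with all of them survives.\<close>
    have "acts_below k L"
      using acts_belowD[OF K(2)] above XZ_anti k KZ
      by (intro below L(1,4) L(5)[of _ 1] L(5)[of _ "- 1"]) auto
    with L that show thesis by blast
  next
    case False
    then have QX: "comm Q (X k)"
      using pauli_twist[OF Q Xk(1)] by blast
    \<comment> \<open>The factor i makes the product hermitian; this is Pauli Y on qubit
      \<open>k\<close>.\<close>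
    define Y where "Y = \<i> \<cdot>\<^sub>m (X k * Z k)"
    have Y: "Y \<in> pauli" "hermitian Y"
    proof -
      show "Y \<in> pauli"
        unfolding Y_def using Xk Zk by (intro pauli_smult n pauli_mult) auto
      show "hermitian Y"
        using Xk Zk XZ_anti[OF k] hermitian_anti[of "X k" "Z k"]
        by (simp add: Y_def hermitian_def adjoint(3) expand)
    qed
    have "twist (1 * - 1) (X k * Z k) Q"
      using Q QX QZ by (intro twist_mult_left twist_sym[of Q]) auto
    then have "anti Y (conj K (X k))"
      unfolding Y_def Q_def[symmetric] using Q by (intro twist_smult_left) auto
    then obtain L1 W1 where L1: "L1 \<in> clifford" "K = L1 * W1" "W1 \<in> impl 1" "conj L1 (X k) = Y"
      "\<And>G \<epsilon>. G \<in> M \<Longrightarrow> comm K G \<Longrightarrow> twist \<epsilon> (X k) G \<Longrightarrow> twist \<epsilon> Y G \<Longrightarrow> \<epsilon> * \<epsilon> = 1 \<Longrightarrow> comm L1 G"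
      using exchange[OF K(1) Xk Y] by metis
    have "twist (- 1 * 1) (X k * Z k) (Z k)"
      using XZ_anti[OF k] by (intro twist_mult_left) (auto simp: comm_iff)
    then have "anti Y (Z k)"
      unfolding Y_def by (intro twist_smult_left) auto
    \<comment> \<open>X_k and Y_k both anticommute with Z_k, so the exchange keeps Z_k
      fixed.\<close>
    then have L1Z: "comm L1 (Z k)"
      using XZ_anti[OF k] KZ by (intro L1(5)[of _ "- 1"]) auto
    have YG: "comm Y G" if "Suc k \<le> j" "j < n" "G = X j \<or> G = Z j" for j G
    proof -
      have "twist (1 * 1) (X k * Z k) G"
        using above[OF that] that by (intro twist_mult_left) auto
      then show ?thesis
        unfolding Y_def using that by (intro twist_smult_left) auto
    qed
    have L1G: "comm L1 G" if "Suc k \<le> j" "j < n" "G = X j \<or> G = Z j" for j G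
      using acts_belowD[OF K(2) that] above[OF that] YG[OF that] that by (intro L1(5)[of _ 1]) auto
    have "twist (1 * - 1) (X k) (X k * Z k)"
      using XZ_anti[OF k] by (intro twist_mult) (auto simp: comm_iff)
    then have "anti (X k) (conj L1 (X k))"
      unfolding L1(4) Y_def by (intro twist_smult) auto
    from exchange[OF L1(1) Xk Xk this, unfolded L1(4)]
    obtain L2 where L2: "L2 \<in> clifford" "L1 = L2 * rot (X k * Y)" "conj L2 (X k) = X k"
      "\<And>G \<epsilon>. G \<in> M \<Longrightarrow> comm L1 G \<Longrightarrow> twist \<epsilon> (X k) G \<Longrightarrow> twist \<epsilon> (X k) G \<Longrightarrow> \<epsilon> * \<epsilon> = 1 \<Longrightarrow> comm L2 G"
      by metis
    have "X k * Y = \<i> \<cdot>\<^sub>m Z k"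
      using unitary_cancel(3)[of "X k" "Z k"] Xk pauli_unitary[of "X k"]
      by (simp add: Y_def expand hermitian_def)
    then have "rot (X k * Y) = on_qubit n k (q1.rot (\<i> \<cdot>\<^sub>m pauli_Z))"
      using k by (simp add: rot_def q1.rot_def on_qubit_smult on_qubit_add on_qubit_one)
    moreover have "q1.unitary (q1.rot (\<i> \<cdot>\<^sub>m pauli_Z))"
      by (rule q1.unitary_rot) (simp_all add: pauli2 smult2 adjoint2 unitary2)
    ultimately have W2: "rot (X k * Y) \<in> impl 0"
      using on_qubit_impl[OF k] by simp
    have "acts_below k L2"
      using L1G above XZ_anti k L1Z
      by (intro below L2(1,3) L2(4)[of _ 1] L2(4)[of _ "- 1"]) auto
    moreover have "rot (X k * Y) * W1 \<in> impl 1"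
      using W2 L1(3) by (rule impl_mult_local)
    moreover have "K = L2 * (rot (X k * Y) * W1)"
      unfolding L1(2) using L2 impl_closed[OF W2] impl_closed[OF L1(3)] by (simp add: assoc)
    ultimately show thesis
      using L2(1) that by blast
  qed
qed

text \<open>Each qubit from \<open>k\<close> down to 1 costs 2 GMS gates by \<open>fix_Z\<close> and
  1 by \<open>fix_X\<close>; the base case is a gate on qubit 0 alone.\<close>

lemma clifford_impl:
  "K \<in> clifford \<Longrightarrow> acts_below (Suc k) K \<Longrightarrow> k < n \<Longrightarrow> K \<in> impl (3 * k)"
proof (induction k arbitrary: K)
  case 0
  then have K: "unitary K" by simp
  obtain A where A: "A \<in> carrier_mat 2 2" "K = on_qubit n 0 A"
    using commutant[of K 0] 0 K by (auto simp: acts_below_def Suc_le_eq)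
  have "q1.unitary A"
    using K A by (intro unitary_on_qubit_iff[OF n]) auto
  then show ?case
    using on_qubit_impl[OF n] A(2) by simp
next
  case (Suc k)
  obtain L W where L: "L \<in> clifford" "W \<in> impl 2" "K = L * W" "conj L (Z (Suc k)) = Z (Suc k)"
    "acts_below (Suc (Suc k)) L"
    using fix_Z[OF Suc.prems] by metis
  obtain L' W' where L': "L' \<in> clifford" "W' \<in> impl 1" "L = L' * W'" "acts_below (Suc k) L'"
    using fix_X[OF L(1,5,4) Suc.prems(3)] by metis
  have "L' * W' * W \<in> impl (3 * k + 1 + 2)"
    using Suc.IH[OF L'(1,4)] Suc.prems L' L by (intro impl_mult) auto
  moreover have "3 * k + 1 + 2 = 3 * Suc k"
    by simp
  ultimately show ?case
    using L(3) L'(3) by metis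
qed

section \<open>Counting the GMS gates\<close>

lemma circuit_impl:
  assumes "input_circuit n C"
  shows "circuit_mat n input_gate_mat C \<in> impl (length (filter is_z_phase C) + 6 * n - 8)"
proof (cases "n = 1")
  case True
  let ?U = "circuit_mat n input_gate_mat C"
  have U: "unitary ?U"
    using assms by (rule input_circuit_unitary)
  \<comment> \<open>There are no other qubits, so the commutation conditions of
    \<open>commutant\<close> hold vacuously.\<close>
  then obtain A where A: "A \<in> carrier_mat 2 2" "?U = on_qubit n 0 A"
    using commutant[of ?U 0] True by auto
  with U have "q1.unitary A"
    by (intro unitary_on_qubit_iff[OF n]) auto
  then have "?U \<in> impl 0"
    using on_qubit_impl[OF n] A(2) by simp
  then show ?thesis
    by (rule impl_mono) simp
next
  case False
  obtain K V where KV: "K \<in> clifford" "V \<in> impl (length (filter is_z_phase C))"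
    "circuit_mat n input_gate_mat C = K * V"
    using circuit_split[OF assms] by metis
  \<comment> \<open>Starting at the top qubit, \<open>acts_below n K\<close> holds
    vacuously.\<close>
  have "K \<in> impl (3 * (n - 1))"
    using KV(1) n by (intro clifford_impl) (auto simp: acts_below_def)
  then have "K * V \<in> impl (3 * (n - 1) + length (filter is_z_phase C))"
    using KV(2) by (rule impl_mult)
  \<comment> \<open>For n \<ge> 2 the subtraction does not truncate and 3 (n - 1) \<le> 6 n -
    8.\<close>
  then show ?thesis
    unfolding KV(3) by (rule impl_mono) (use n False in simp)
qed

end

end

theorem theorem4p1:
  fixes n N :: nat and C :: "input_gate list"
  assumes "input_circuit n C"
    and "length (filter is_z_phase C) = N"
  shows "\<exists>D :: output_gate list.
           output_circuit n D \<and>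
           length (filter is_gms D) \<le> N + 6 * n - 8 \<and>
           equal_up_to_global_phase (circuit_mat n output_gate_mat D) (circuit_mat n input_gate_mat C)"
proof (cases "n = 0")
  case True
  \<comment> \<open>Every gate needs a qubit, so the circuit is empty.\<close>
  have "\<not> valid_input_gate 0 g" for g
    by (cases g) auto
  then have "C = []"
    using assms(1) True by (cases C) (auto simp: input_circuit_def)
  then show ?thesis
    by (intro exI[of _ "[]"])
      (auto simp: output_circuit_def equal_up_to_global_phase_def circuit_mat_def intro!: exI[of _ 0])
next
  case False
  interpret qubits n .
  let ?U = "circuit_mat n input_gate_mat C"
  obtain D c where D: "output_circuit n D" "length (filter is_gms D) \<le> N + 6 * n - 8" "cmod c = 1"
    "?U = c \<cdot>\<^sub>m circuit_mat n output_gate_mat D"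
    using circuit_impl[OF _ assms(1)] False assms(2) by (auto simp: impl_def)
  \<comment> \<open>Moving the phase to the other side inverts \<open>c\<close> to
    \<open>cnj c\<close>, whose argument is the required angle.\<close>
  have "cnj c \<noteq> 0" "cmod (cnj c) = 1"
    using D(3) by auto
  then have "cis (Arg (cnj c)) = cnj c"
    by (simp add: cis_Arg sgn_div_norm)
  moreover have "circuit_mat n output_gate_mat D = cnj c \<cdot>\<^sub>m ?U"
    unfolding D(4) using D(3) circuit_M[of output_gate_mat D] output_gate_M
    by (simp add: expand cnj_mult_unit)
  ultimately have "equal_up_to_global_phase (circuit_mat n output_gate_mat D) ?U"
    unfolding equal_up_to_global_phase_def by metis
  with D(1,2) show ?thesis by blast
qed

end
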